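(* There is a randomized CONGEST algorithm that, given an undirected unweighted $n$-vertex graph $G$ of diameter $D$ and girth $g$ (length of a shortest cycle), computes with high probability a value $\tilde{g}$ with $g\le \tilde{g}\le \left(2-\frac{1}{g}\right)g$ (the length of a cycle of $G$), in $\tilde{O}(\sqrt{n}+D)$ rounds.
   Context: CONGEST model: the communication network is the undirected graph $G=(V,E)$, $n=|V|$; each node has a unique identifier in $\{0,\dots,n-1\}$, knows its own and its neighbours' identifiers; computation proceeds in synchronous rounds in which each node may send a message of $O(\log n)$ bits to each neighbour; local computation is free. $D$ is the hop diameter of $G$. $\tilde{O}$ hides polylogarithmic factors in $n$. *)

theory Defs
  imports "HOL-Probability.Probability"
begin

definition graph_on :: "nat \<Rightarrow> (nat \<Rightarrow> nat \<Rightarrow> bool) \<Rightarrow> bool" where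
  "graph_on n E \<longleftrightarrow> (\<forall>u v. E u v \<longrightarrow> u < n \<and> v < n) \<and> (\<forall>u v. E u v \<longrightarrow> E v u) \<and> (\<forall>u. \<not> E u u)"

definition is_walk :: "(nat \<Rightarrow> nat \<Rightarrow> bool) \<Rightarrow> nat list \<Rightarrow> bool" where
  "is_walk E xs \<longleftrightarrow> xs \<noteq> [] \<and> (\<forall>i. Suc i < length xs \<longrightarrow> E (xs ! i) (xs ! Suc i))"

definition connected_graph :: "nat \<Rightarrow> (nat \<Rightarrow> nat \<Rightarrow> bool) \<Rightarrow> bool" where
  "connected_graph n E \<longleftrightarrow>
     (\<forall>u v. u < n \<and> v < n \<longrightarrow> (\<exists>xs. is_walk E xs \<and> hd xs = u \<and> last xs = v))"

definition hop_dist :: "(nat \<Rightarrow> nat \<Rightarrow> bool) \<Rightarrow> nat \<Rightarrow> nat \<Rightarrow> nat" where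
  "hop_dist E u v = (LEAST k. \<exists>xs. is_walk E xs \<and> hd xs = u \<and> last xs = v \<and> length xs = Suc k)"

definition hop_diameter :: "nat \<Rightarrow> (nat \<Rightarrow> nat \<Rightarrow> bool) \<Rightarrow> nat" where
  "hop_diameter n E = Max {hop_dist E u v | u v. u < n \<and> v < n}"

definition is_cycle :: "(nat \<Rightarrow> nat \<Rightarrow> bool) \<Rightarrow> nat list \<Rightarrow> bool" where
  "is_cycle E xs \<longleftrightarrow> length xs \<ge> 3 \<and> distinct xs \<and> is_walk E xs \<and> E (last xs) (hd xs)"

definition has_cycle :: "(nat \<Rightarrow> nat \<Rightarrow> bool) \<Rightarrow> bool" where
  "has_cycle E \<longleftrightarrow> (\<exists>xs. is_cycle E xs)"

definition girth :: "(nat \<Rightarrow> nat \<Rightarrow> bool) \<Rightarrow> nat" where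
  "girth E = (LEAST k. \<exists>xs. is_cycle E xs \<and> length xs = k)"

text \<open>Local states are encoded as natural numbers (all information at a node is finite).
  c_init n v N r : initial state of node v, knowing n, its id v, its neighbours' ids N and
                   its private random bit string r.
  c_bits n       : number of private random bits per node.
  c_send n s u   : message sent by a node in state s to neighbour u.
  c_recv s M     : new state given old state and received messages (M u = message from u).
  c_halted s / c_out s : halting flag and output value.\<close>
record congest_alg =
  c_init :: "nat \<Rightarrow> nat \<Rightarrow> nat set \<Rightarrow> bool list \<Rightarrow> nat"
  c_bits :: "nat \<Rightarrow> nat"
  c_send :: "nat \<Rightarrow> nat \<Rightarrow> nat \<Rightarrow> bool list"
  c_recv :: "nat \<Rightarrow> (nat \<Rightarrow> bool list) \<Rightarrow> nat"
  c_halted :: "nat \<Rightarrow> bool"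
  c_out :: "nat \<Rightarrow> nat"

definition congest_bandwidth :: "congest_alg \<Rightarrow> real \<Rightarrow> bool" where
  "congest_bandwidth A B \<longleftrightarrow> (\<forall>n s u. real (length (c_send A n s u)) \<le> B * log 2 (real n + 2))"

fun exec :: "congest_alg \<Rightarrow> nat \<Rightarrow> (nat \<Rightarrow> nat \<Rightarrow> bool) \<Rightarrow> (nat \<Rightarrow> bool list) \<Rightarrow> nat \<Rightarrow> nat \<Rightarrow> nat" where
  "exec A n E r 0 v = c_init A n v {u. u < n \<and> E v u} (r v)"
| "exec A n E r (Suc t) v =
     c_recv A (exec A n E r t v) (\<lambda>u. if u < n \<and> E u v then c_send A n (exec A n E r t u) v else [])"

definition rand_bits :: "congest_alg \<Rightarrow> nat \<Rightarrow> (nat \<Rightarrow> bool list) pmf" where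
  "rand_bits A n = Pi_pmf {..<n} [] (\<lambda>_. pmf_of_set {xs. length xs = c_bits A n})"

definition all_halted :: "congest_alg \<Rightarrow> nat \<Rightarrow> (nat \<Rightarrow> nat \<Rightarrow> bool) \<Rightarrow> (nat \<Rightarrow> bool list) \<Rightarrow> nat \<Rightarrow> bool" where
  "all_halted A n E r t \<longleftrightarrow> (\<forall>v<n. c_halted A (exec A n E r t v))"

definition term_round :: "congest_alg \<Rightarrow> nat \<Rightarrow> (nat \<Rightarrow> nat \<Rightarrow> bool) \<Rightarrow> (nat \<Rightarrow> bool list) \<Rightarrow> nat" where
  "term_round A n E r = (LEAST t. all_halted A n E r t)"

end

theory Submission
  imports Defs
begin

text \<open>Every node learns, by pipelined source detection, its distances to the roughly \<open>\<surd>n\<close> nearest nodes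
  and to about \<open>\<surd>n\<close> random sources. If on a shortest cycle of length \<open>g\<close> all balls of radius
  \<open>m = \<lfloor>(g - 1) / 2\<rfloor>\<close> are small, the detection from the nodes of the cycle itself exposes an edge that
  closes a detour of length at most \<open>g\<close>. Otherwise some large ball contains a random source with high
  probability, and the detection from it exposes an edge that closes a detour of length at most
  \<open>2 * m + g \<le> 2 * g - 1\<close>. The length of such a detour only bounds the length of a cycle through the
  edge, so the lightest exposed edge is elected and a breadth-first search in the graph without it
  yields the exact length of a shortest cycle through it. The unknown diameter is guessed by
  doubling.\<close>

section \<open>Walks, distances and cycles\<close>

text \<open>A distance reported by a neighbour may belong to a walk through the receiving node
  itself, and then it yields no cycle. Reports of distinct neighbours are therefore paired only if
  neither exceeds the node's own estimate: a walk through the node would have left a strictly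
  smaller estimate there. Pipelining must stop after a number of rounds fixed in advance, which
  presupposes a bound on the diameter. Node 0 is always a source and acts as a probe: under the
  guess \<open>h\<close>, a node that has not learnt a distance at most \<open>h\<close> to node 0
  vetoes the phase; without a veto the triangle inequality gives diameter at most
  \<open>2 * h\<close>. So every accepted phase is correct, whichever guess it used, and the stage
  lengths are multiples of \<open>2 * h\<close>, up to rounding. A node is a source if its
  \<open>b\<close> private bits are all set, with \<open>b\<close> least such that n \<le> 4 ^ b,
  hence with probability of order 1 / \<surd>n. Balls count as large from order \<surd>n * log n on;
  the logarithm pays for the failure probability 1 / n.\<close>

lemma is_walk_iff_relpowp:
  "(\<exists>xs. is_walk E xs \<and> hd xs = u \<and> last xs = v \<and> length xs = Suc k) \<longleftrightarrow> (E ^^ k) u v"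
proof
  assume "\<exists>xs. is_walk E xs \<and> hd xs = u \<and> last xs = v \<and> length xs = Suc k"
  then obtain xs where xs: "is_walk E xs" "hd xs = u" "last xs = v" "length xs = Suc k" by blast
  then have ne: "xs \<noteq> []" by auto
  have "xs ! 0 = u" "xs ! k = v" "\<forall>i<k. E (xs ! i) (xs ! Suc i)"
    using xs ne by (auto simp: hd_conv_nth last_conv_nth is_walk_def)
  then show "(E ^^ k) u v" unfolding relpowp_fun_conv by (intro exI[of _ "(!) xs"]) auto
next
  assume "(E ^^ k) u v"
  then obtain f where f: "f 0 = u" "f k = v" "\<forall>i<k. E (f i) (f (Suc i))"
    unfolding relpowp_fun_conv by blast
  have nth: "map f [0..<Suc k] ! i = f i" if "i \<le> k" for i
    using that by (simp del: upt_Suc)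
  have "is_walk E (map f [0..<Suc k])"
    unfolding is_walk_def using f(3) by (auto simp: nth simp del: upt_Suc)
  moreover have "hd (map f [0..<Suc k]) = u" "last (map f [0..<Suc k]) = v"
    using f by (auto simp: hd_map last_map simp del: upt_Suc)
  ultimately show "\<exists>xs. is_walk E xs \<and> hd xs = u \<and> last xs = v \<and> length xs = Suc k"
    by (intro exI[of _ "map f [0..<Suc k]"]) auto
qed

text \<open>A repeated vertex could be short-cut, against minimality.\<close>

lemma shortest_walk_distinct:
  assumes "(E ^^ k) u v" and least: "\<And>j. j < k \<Longrightarrow> \<not> (E ^^ j) u v"
  obtains xs where "is_walk E xs" "distinct xs" "hd xs = u" "last xs = v" "length xs = Suc k"
proof -
  obtain xs where xs: "is_walk E xs" "hd xs = u" "last xs = v" "length xs = Suc k"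
    using assms(1) is_walk_iff_relpowp[of E u v k] by blast
  then have ne: "xs \<noteq> []" by auto
  have ends: "xs ! 0 = u" "xs ! k = v" and step: "\<forall>i<k. E (xs ! i) (xs ! Suc i)"
    using xs ne by (auto simp: hd_conv_nth last_conv_nth is_walk_def)
  have False if "i < j" "j \<le> k" "xs ! i = xs ! j" for i j
  proof -
    have "(E ^^ i) u (xs ! i)" unfolding relpowp_fun_conv
      using ends step that by (intro exI[of _ "(!) xs"]) auto
    moreover have "(E ^^ (k - j)) (xs ! j) v" unfolding relpowp_fun_conv
      using ends step that by (intro exI[of _ "\<lambda>l. xs ! (j + l)"]) auto
    ultimately have "(E ^^ (i + (k - j))) u v"
      using that(3) by (auto simp: relpowp_add)
    with least[of "i + (k - j)"] that show False by simp
  qed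
  then have "distinct xs"
    unfolding distinct_conv_nth using xs(4)
    by (metis less_Suc_eq_le nat_neq_iff)
  with xs that show ?thesis by blast
qed

lemma shortest_walk_less:
  assumes "(E ^^ k) u v" "\<And>j. j < k \<Longrightarrow> \<not> (E ^^ j) u v"
    and bound: "\<And>a b. E a b \<Longrightarrow> a < n \<and> b < n" and "u < n"
  shows "k < n"
proof -
  obtain xs where xs: "is_walk E xs" "distinct xs" "hd xs = u" "last xs = v" "length xs = Suc k"
    using shortest_walk_distinct assms(1,2) by blast
  have "xs ! i < n" if "i < length xs" for i
  proof (cases i)
    case 0
    then show ?thesis using xs assms(4) by (cases xs) auto
  next
    case (Suc j)
    then show ?thesis using xs(1) that bound unfolding is_walk_def by auto
  qed
  then have "set xs \<subseteq> {..<n}" by (auto simp: in_set_conv_nth)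
  then have "card (set xs) \<le> n" using card_mono[of "{..<n}"] by fastforce
  with xs show ?thesis by (simp add: distinct_card)
qed

lemma relpowp_sym:
  assumes "\<And>a b. E a b \<Longrightarrow> E b a" "(E ^^ k) u v"
  shows "(E ^^ k) v u"
  using assms(2)
proof (induction k arbitrary: v)
  case (Suc k)
  then obtain w where "(E ^^ k) u w" "E w v" by auto
  then have "E v w" "(E ^^ k) w u" using Suc.IH assms(1) by auto
  then show ?case using relpowp_Suc_I2 by metis
qed auto

definition delete_edge :: "(nat \<Rightarrow> nat \<Rightarrow> bool) \<Rightarrow> nat \<Rightarrow> nat \<Rightarrow> nat \<Rightarrow> nat \<Rightarrow> bool" where
  "delete_edge E u v a b \<longleftrightarrow> E a b \<and> \<not> (a = u \<and> b = v) \<and> \<not> (a = v \<and> b = u)"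

text \<open>A shortest walk repeats no vertex, and it has at least two edges because its ends differ
  and the direct edge is deleted; so the edge closes it to a genuine cycle.\<close>

lemma cycle_through_edge:
  assumes "E v u" "u \<noteq> v" and walk: "(delete_edge E u v ^^ k) u v"
    and least: "\<And>j. j < k \<Longrightarrow> \<not> (delete_edge E u v ^^ j) u v"
  shows "\<exists>xs. is_cycle E xs \<and> length xs = Suc k"
proof -
  obtain xs where xs: "is_walk (delete_edge E u v) xs" "distinct xs" "hd xs = u" "last xs = v"
      "length xs = Suc k"
    using shortest_walk_distinct walk least by blast
  have "k \<noteq> 0" using walk \<open>u \<noteq> v\<close> by (cases k) auto
  moreover have "k \<noteq> 1" using walk by (auto simp: delete_edge_def)
  ultimately have "3 \<le> length xs" using xs(5) by simp
  moreover have "is_walk E xs" using xs(1) by (auto simp: is_walk_def delete_edge_def)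
  ultimately show ?thesis using xs \<open>E v u\<close> unfolding is_cycle_def by blast
qed

section \<open>Hop distances in a connected network\<close>

locale network =
  fixes n :: nat and E :: "nat \<Rightarrow> nat \<Rightarrow> bool"
  assumes graph: "graph_on n E" and connected: "connected_graph n E"
begin

lemma E_less: "E a b \<Longrightarrow> a < n \<and> b < n"
  and E_sym: "E a b \<Longrightarrow> E b a"
  and E_irrefl: "\<not> E a a"
  using graph unfolding graph_on_def by blast+

abbreviation dist :: "nat \<Rightarrow> nat \<Rightarrow> nat" where "dist \<equiv> hop_dist E"

lemma dist_eq: "dist u v = (LEAST k. (E ^^ k) u v)"
  unfolding hop_dist_def is_walk_iff_relpowp ..

lemma dist_le: "(E ^^ k) u v \<Longrightarrow> dist u v \<le> k"
  unfolding dist_eq by (rule Least_le)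

lemma dist_walk: assumes "u < n" "v < n" shows "(E ^^ dist u v) u v"
proof -
  obtain xs where "is_walk E xs" "hd xs = u" "last xs = v"
    using connected assms unfolding connected_graph_def by blast
  moreover then have "length xs = Suc (length xs - 1)"
    by (cases xs) (auto simp: is_walk_def)
  ultimately have "(E ^^ (length xs - 1)) u v" using is_walk_iff_relpowp by metis
  then show ?thesis unfolding dist_eq by (rule LeastI)
qed

lemma dist_less: assumes "u < n" "v < n" shows "dist u v < n"
proof (rule shortest_walk_less[OF dist_walk[OF assms] _ E_less assms(1)])
  show "\<not> (E ^^ j) u v" if "j < dist u v" for j
    using dist_le[of j u v] that by auto
qed

lemma dist_sym: assumes "u < n" "v < n" shows "dist u v = dist v u"
  using dist_walk[of u v] dist_walk[of v u] dist_le relpowp_sym[of E, OF E_sym] assms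
  by (metis order_antisym)

lemma dist_triangle: assumes "u < n" "v < n" "w < n" shows "dist u w \<le> dist u v + dist v w"
  using dist_walk[of u v] dist_walk[of v w] assms by (intro dist_le) (auto simp: relpowp_add)

lemma dist_edge: assumes "E u v" "s < n" shows "dist s v \<le> Suc (dist s u)"
  using dist_walk[of s u] assms E_less by (intro dist_le) auto

lemma dist_self [simp]: "dist u u = 0"
  using dist_le[of 0 u u] by simp

lemma dist_eq_0: assumes "u < n" "v < n" "dist u v = 0" shows "u = v"
  using dist_walk[OF assms(1,2)] assms(3) by simp

lemma dist_pred: assumes "s < n" "v < n" "dist s v = Suc k" obtains u where "E u v" "dist s u = k"
proof -
  obtain u where u: "(E ^^ k) s u" "E u v"
    using dist_walk[OF assms(1,2)] assms(3) by auto
  then have "dist s u \<le> k" using dist_le by blast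
  moreover have "dist s v \<le> Suc (dist s u)" using dist_edge u assms by blast
  ultimately show ?thesis using that u assms by simp
qed

lemma finite_dists: "finite {dist u v |u v. u < n \<and> v < n}"
proof -
  have "{dist u v |u v. u < n \<and> v < n} = (\<lambda>(u, v). dist u v) ` ({..<n} \<times> {..<n})" by auto
  then show ?thesis by simp
qed

lemma dist_le_diameter: assumes "u < n" "v < n" shows "dist u v \<le> hop_diameter n E"
  unfolding hop_diameter_def using assms by (intro Max_ge finite_dists) auto

lemma diameter_attained:
  assumes "0 < n"
  obtains u v where "u < n" "v < n" "hop_diameter n E = dist u v"
proof -
  have "hop_diameter n E \<in> {dist u v |u v. u < n \<and> v < n}"
    unfolding hop_diameter_def using assms by (intro Max_in finite_dists) auto
  then show ?thesis using that by blast
qed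

end

text \<open>An edge on which \<open>f\<close> is constant, or else a maximum of \<open>f\<close> on the cycle, closes the detour
  from the source.\<close>

lemma cycle_level_edge_or_peak:
  fixes f :: "nat \<Rightarrow> nat"
  assumes cyc: "is_cycle E xs" and "x \<in> set xs" and fx: "f x \<le> d"
    and sym: "\<And>a b. E a b \<Longrightarrow> E b a"
    and lip: "\<And>a b. E a b \<Longrightarrow> f b \<le> Suc (f a)"
  obtains (level) u v where "u \<in> set xs" "v \<in> set xs" "E u v" "f u = f v"
      "2 * f u + 1 \<le> 2 * d + length xs"
    | (peak) u v w where "u \<in> set xs" "v \<in> set xs" "w \<in> set xs" "E u v" "E u w" "v \<noteq> w"
      "f u = Suc (f v)" "f u = Suc (f w)" "2 * f u \<le> 2 * d + length xs"
proof -
  define g where "g = length xs"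
  have g3: "g \<ge> 3" and dis: "distinct xs" and walk: "is_walk E xs" and close: "E (last xs) (hd xs)"
    using cyc unfolding is_cycle_def g_def by auto
  obtain i0 where i0: "i0 < g" "xs ! i0 = x"
    using \<open>x \<in> set xs\<close> unfolding in_set_conv_nth g_def by blast
  define c where "c i = xs ! ((i0 + i) mod g)" for i
  have cset: "c i \<in> set xs" for i
  proof -
    have "(i0 + i) mod g < g" using g3 by simp
    then show ?thesis unfolding c_def g_def by (rule nth_mem)
  qed
  have edge: "E (c i) (c (Suc i))" for i
  proof (cases "Suc ((i0 + i) mod g) = g")
    case True
    have "xs \<noteq> []" using g3 by (auto simp: g_def)
    moreover have "(i0 + i) mod g = length xs - 1" "(i0 + Suc i) mod g = 0"
      using True by (simp_all add: mod_Suc g_def)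
    ultimately have "c (Suc i) = hd xs" "c i = last xs"
      unfolding c_def by (simp_all add: hd_conv_nth last_conv_nth)
    then show ?thesis using close by simp
  next
    case False
    then have "Suc ((i0 + i) mod g) < g" using g3 mod_less_divisor[of g "i0 + i"] by linarith
    then show ?thesis using walk False
      unfolding c_def is_walk_def by (auto simp: mod_Suc g_def)
  qed
  have c0: "c 0 = x" and cg: "c g = x" using i0 by (auto simp: c_def)
  \<comment> \<open>Both ways round from \<open>x\<close>, \<open>f\<close> grows by at most 1 per
    edge. Adding the two bounds gives 2 * f \<le> 2 * d + g at every vertex, and one less on a level
    edge.\<close>
  have up: "f (c i) \<le> d + i" for i
    by (induction i) (use fx c0 lip[OF edge] in \<open>auto intro: le_trans\<close>)
  have down: "f (c (g - i)) \<le> d + i" if "i \<le> g" for i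
    using that
  proof (induction i)
    case (Suc i)
    have "Suc (g - Suc i) = g - i" using Suc.prems by simp
    then have "E (c (g - i)) (c (g - Suc i))" using edge[of "g - Suc i"] sym by simp
    then show ?case using lip Suc by fastforce
  qed (use fx cg in auto)
  have down': "f (c i) \<le> d + (g - i)" if "i \<le> g" for i
    using down[of "g - i"] that by simp
  show thesis
  proof (cases "\<exists>i<g. f (c i) = f (c (Suc i))")
    case True
    then obtain i where i: "i < g" "f (c i) = f (c (Suc i))" by blast
    have "2 * f (c i) + 1 \<le> 2 * d + g" using up[of i] down'[of "Suc i"] i by linarith
    then show ?thesis using level[OF cset cset edge] i by (simp add: g_def)
  next
    case False
    have per: "c (i + g) = c i" for i unfolding c_def by (metis add.assoc mod_add_self2)
    have ne: "f (c i) \<noteq> f (c (Suc i))" if "i \<le> g" for i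
    proof (cases "i = g")
      case True
      have "f (c 0) \<noteq> f (c (Suc 0))" using False g3 by auto
      then show ?thesis using True per[of 0] per[of 1] by simp
    qed (use False that in auto)
    \<comment> \<open>The maximum is taken over the indices 1 to \<open>g\<close>, so that
      \<open>m\<close> has a predecessor and only its successor may wrap around.\<close>
    have "finite ((\<lambda>i. f (c i)) ` {1..g})" "(\<lambda>i. f (c i)) ` {1..g} \<noteq> {}" using g3 by auto
    then obtain m where m: "m \<in> {1..g}" "Max ((\<lambda>i. f (c i)) ` {1..g}) = f (c m)"
      using Max_in by (metis (no_types, lifting) imageE)
    have mx: "\<forall>i\<in>{1..g}. f (c i) \<le> f (c m)"
      unfolding m(2)[symmetric] by (auto intro!: Max_ge)
    obtain m' where m': "m = Suc m'" using m by (cases m) auto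
    have le1: "f (c m') \<le> f (c m)"
    proof (cases "m' = 0")
      case True
      then show ?thesis using bspec[OF mx, of g] c0 cg g3 by simp
    qed (use mx m m' in auto)
    have le2: "f (c (Suc m)) \<le> f (c m)"
    proof (cases "m = g")
      case True
      then have "c (Suc m) = c 1" using per[of 1] by (simp add: add.commute)
      then show ?thesis using mx g3 by auto
    qed (use mx m in auto)
    have "f (c m') \<noteq> f (c m)" "f (c (Suc m)) \<noteq> f (c m)"
      using ne[of m'] ne[of m] m m' by auto
    moreover have "f (c m) \<le> Suc (f (c m'))" "f (c m) \<le> Suc (f (c (Suc m)))"
      using lip edge sym m' by blast+
    ultimately have s1: "f (c m) = Suc (f (c m'))" and s2: "f (c m) = Suc (f (c (Suc m)))"
      using le1 le2 by linarith+
    \<comment> \<open>The two neighbours of the peak could coincide only if \<open>g\<close> divided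
      2.\<close>
    have "(i0 + m') mod g \<noteq> (i0 + Suc m) mod g"
    proof
      assume "(i0 + m') mod g = (i0 + Suc m) mod g"
      then have "g dvd (i0 + Suc m) - (i0 + m')"
        using mod_eq_dvd_iff_nat[of "i0 + m'" "i0 + Suc m" g] m' by simp
      then have "g dvd 2" using m' by simp
      then show False using g3 by (auto dest: dvd_imp_le)
    qed
    then have "c m' \<noteq> c (Suc m)"
      unfolding c_def
      using nth_eq_iff_index_eq[OF dis, folded g_def, of "(i0 + m') mod g" "(i0 + Suc m) mod g"] g3
      by simp
    moreover have "2 * f (c m) \<le> 2 * d + g"
      using up[of m] down'[of m] m by auto
    ultimately show ?thesis
      using peak[OF cset cset cset, of m m' "Suc m"] edge[of m] edge[of m'] m' sym s1 s2
      by (auto simp: g_def)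
  qed
qed

section \<open>Source detection\<close>

text \<open>Distances are at most \<open>n\<close>, where \<open>n\<close> stands for ``unknown''; an entry (distance \<open>d\<close>, source
  \<open>s\<close>) is the key \<open>d * n + s\<close>, so the order of keys is lexicographic. \<open>H u\<close> is the set of keys that
  \<open>u\<close> has sent.\<close>

definition estimate :: "nat \<Rightarrow> nat set \<Rightarrow> nat \<Rightarrow> bool \<Rightarrow> (nat \<Rightarrow> nat set) \<Rightarrow> nat \<Rightarrow> nat" where
  "estimate n N v b H s = Inf (insert (if b \<and> s = v then 0 else n) {Suc d |d u. u \<in> N \<and> d * n + s \<in> H u})"

text \<open>The default \<open>n * n\<close> means that there is nothing to send: keys with the
  unknown distance \<open>n\<close> are at least \<open>n * n\<close>, so they never compete with
  real entries.\<close>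

definition next_key :: "nat \<Rightarrow> nat set \<Rightarrow> nat \<Rightarrow> bool \<Rightarrow> (nat \<Rightarrow> nat set) \<Rightarrow> nat" where
  "next_key n N v b H =
     Inf (insert (n * n) ((\<lambda>s. estimate n N v b H s * n + s) ` {..<n} - H v))"

lemma estimate_cong:
  "(\<And>u. u \<in> N \<Longrightarrow> H u = H' u) \<Longrightarrow> estimate n N v b H s = estimate n N v b H' s"
  unfolding estimate_def by (intro arg_cong[where f = Inf] arg_cong2[where f = insert]) auto

text \<open>Locality: only keys of the node and its neighbours matter, and these are all that a node
  sees. The congruence rules for candidates, flooding steps and local keys serve the same
  purpose.\<close>

lemma next_key_cong:
  assumes "\<And>u. u \<in> insert v N \<Longrightarrow> H u = H' u"
  shows "next_key n N v b H = next_key n N v b H'"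
  using assms unfolding next_key_def by (simp add: estimate_cong[of N H H'])

lemma estimate_le: "estimate n N v b H s \<le> n"
proof -
  have "estimate n N v b H s \<le> (if b \<and> s = v then 0 else n)"
    unfolding estimate_def by (intro wellorder_Inf_le1) simp
  then show ?thesis by (simp split: if_splits)
qed

lemma estimate_own: "estimate n N v True H v = 0"
  unfolding estimate_def by (intro le_0_eq[THEN iffD1] wellorder_Inf_le1) simp

lemma estimate_neighbour: "u \<in> N \<Longrightarrow> d * n + s \<in> H u \<Longrightarrow> estimate n N v b H s \<le> Suc d"
  unfolding estimate_def by (intro wellorder_Inf_le1) blast

lemma estimate_cases:
  assumes "estimate n N v b H s < n"
  obtains (own) "b" "s = v" "estimate n N v b H s = 0"
    | (neighbour) d u where "u \<in> N" "d * n + s \<in> H u" "estimate n N v b H s = Suc d"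
proof -
  have "estimate n N v b H s \<in>
      insert (if b \<and> s = v then 0 else n) {Suc d |d u. u \<in> N \<and> d * n + s \<in> H u}"
    unfolding estimate_def by (intro wellorder_InfI[of "if b \<and> s = v then 0 else n"]) simp
  then show ?thesis using that assms by (auto split: if_splits)
qed

lemma next_key_le: "next_key n N v b H \<le> n * n"
  unfolding next_key_def by (intro wellorder_Inf_le1) simp

lemma next_key_le_estimate:
  "s < n \<Longrightarrow> estimate n N v b H s * n + s \<notin> H v
    \<Longrightarrow> next_key n N v b H \<le> estimate n N v b H s * n + s"
  unfolding next_key_def by (intro wellorder_Inf_le1) auto

lemma next_key_cases:
  obtains (idle) "next_key n N v b H = n * n"
    | (entry) s where "s < n" "next_key n N v b H = estimate n N v b H s * n + s"
        "estimate n N v b H s * n + s \<notin> H v"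
proof -
  have "next_key n N v b H \<in>
      insert (n * n) ((\<lambda>s. estimate n N v b H s * n + s) ` {..<n} - H v)"
    unfolding next_key_def by (intro wellorder_InfI[of "n * n"]) simp
  then show ?thesis using that by auto
qed

lemma key_eqD:
  fixes d e n s t :: nat
  assumes "d * n + s = e * n + t" "s < n" "t < n"
  shows "d = e \<and> s = t"
proof -
  have "(d * n + s) div n = d" "(e * n + t) div n = e" using assms(2,3) by auto
  then show ?thesis using assms(1) by auto
qed

lemma key_le_dist:
  fixes d e n s t :: nat
  assumes "d * n + s \<le> e * n + t" "t < n"
  shows "d \<le> e"
proof (rule ccontr)
  assume "\<not> d \<le> e"
  then have "Suc e * n \<le> d * n" by (intro mult_le_mono1) simp
  then show False using assms by simp
qed

section \<open>Pipelined detection in a fixed network\<close>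

context network
begin

definition nbs :: "nat \<Rightarrow> nat set" where "nbs v = {u. u < n \<and> E v u}"

lemma nbs_iff: "u \<in> nbs v \<longleftrightarrow> E u v"
  using E_less E_sym unfolding nbs_def by blast

fun sent :: "nat set \<Rightarrow> nat \<Rightarrow> nat \<Rightarrow> nat set" where
  "sent S 0 v = {}"
| "sent S (Suc t) v = insert (next_key n (nbs v) v (v \<in> S) (sent S t)) (sent S t v)"

abbreviation est :: "nat set \<Rightarrow> nat \<Rightarrow> nat \<Rightarrow> nat \<Rightarrow> nat" where
  "est S t v s \<equiv> estimate n (nbs v) v (v \<in> S) (sent S t) s"

declare sent.simps(2) [simp del]

lemma sent_mono: "t \<le> t' \<Longrightarrow> sent S t v \<subseteq> sent S t' v"
  by (induction t' arbitrary: t rule: nat_induct) (auto simp: le_Suc_eq sent.simps(2))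

lemma est_antimono: assumes "t \<le> t'" shows "est S t' v s \<le> est S t v s"
proof (cases "est S t v s < n")
  case True
  then show ?thesis
  proof (cases rule: estimate_cases)
    case own
    then show ?thesis by (simp add: estimate_own)
  next
    case (neighbour d u)
    then have "d * n + s \<in> sent S t' u" using sent_mono assms by blast
    then show ?thesis using neighbour estimate_neighbour by simp
  qed
next
  case False
  then show ?thesis using estimate_le by (meson le_trans not_le_imp_less less_imp_le)
qed

text \<open>The hypothesis \<open>d < n\<close> excludes the idle key \<open>n * n\<close>, which
  decodes to distance \<open>n\<close> and source 0; any other key was built from the estimate of
  its round.\<close>

lemma sentD:
  assumes "d * n + s \<in> sent S t v" "s < n" "d < n"
  obtains t' where "t' < t" "est S t' v s = d"
  using assms(1)
proof (induction t)
  case (Suc t)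
  show ?case
  proof (cases "d * n + s \<in> sent S t v")
    case True
    then show ?thesis using Suc by (meson less_SucI)
  next
    case False
    then have eq: "d * n + s = next_key n (nbs v) v (v \<in> S) (sent S t)"
      using Suc.prems by (simp add: sent.simps(2))
    show ?thesis
    proof (cases rule: next_key_cases[of n "nbs v" v "v \<in> S" "sent S t"])
      case idle
      then have "d * n + s = n * n + 0" using eq by simp
      then show ?thesis using key_eqD[of d n s n 0] assms by auto
    next
      case (entry s')
      then have "est S t v s = d" using key_eqD[of d n s _ s'] eq assms by auto
      then show ?thesis using Suc.prems(1)[of t] by simp
    qed
  qed
qed simp

lemma est_le_sent:
  assumes "d * n + s \<in> sent S t v" "s < n" "d < n"
  shows "est S t v s \<le> d"
proof -
  obtain t' where "t' < t" "est S t' v s = d" using sentD[OF assms] by blast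
  then show ?thesis using est_antimono[of t' t v S s] by simp
qed

definition avoiding :: "nat \<Rightarrow> nat \<Rightarrow> nat \<Rightarrow> bool" where
  "avoiding w a b \<longleftrightarrow> E a b \<and> a \<noteq> w \<and> b \<noteq> w"

text \<open>If the walk along which \<open>v\<close> learnt its distance passed through \<open>w\<close>, then \<open>w\<close> had sent a smaller
  distance before.\<close>

lemma sent_walk_avoiding:
  assumes "d * n + s \<in> sent S t v" "s < n" "d < n" "w \<noteq> v"
  shows "s \<in> S \<and> (est S t w s < d \<or> (avoiding w ^^ d) s v)"
  using assms(1,3,4)
proof (induction t arbitrary: d v w)
  case (Suc t)
  from sentD[OF Suc.prems(1) assms(2) Suc.prems(2)]
  obtain t' where t': "t' < Suc t" "est S t' v s = d" by blast
  then have "est S t' v s < n" using Suc.prems by simp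
  then show ?case
  proof (cases rule: estimate_cases)
    case own
    then show ?thesis using t' by auto
  next
    case (neighbour d' u)
    have d: "d = Suc d'" using neighbour t' by simp
    have snt: "d' * n + s \<in> sent S t u"
      using neighbour sent_mono[of t' t S u] t' by auto
    have "E u v" using neighbour nbs_iff by simp
    show ?thesis
    proof (cases "w = u")
      case True
      \<comment> \<open>The avoided vertex is the very neighbour that sent the entry: having sent
        \<open>d'\<close>, its estimate is below \<open>d\<close>. For \<open>s \<in> S\<close> the
        induction hypothesis is used with \<open>v\<close> as the avoided vertex.\<close>
      have "est S t u s \<le> d'" using est_le_sent[OF snt assms(2)] d Suc.prems by simp
      moreover have "s \<in> S" using Suc.IH[OF snt, of v] d Suc.prems \<open>E u v\<close> E_irrefl by auto
      ultimately show ?thesis using True d est_antimono[of t "Suc t" u S s] by auto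
    next
      case False
      then have "s \<in> S" and or: "est S t w s < d' \<or> (avoiding w ^^ d') s u"
        using Suc.IH[OF snt] d Suc.prems by auto
      moreover have "avoiding w u v" using \<open>E u v\<close> False Suc.prems unfolding avoiding_def by auto
      ultimately show ?thesis using d est_antimono[of t "Suc t" w S s] by auto
    qed
  qed
qed simp

definition sdist :: "nat set \<Rightarrow> nat \<Rightarrow> nat \<Rightarrow> nat" where
  "sdist S v s = (if s \<in> S then dist s v else n)"

abbreviation skey :: "nat set \<Rightarrow> nat \<Rightarrow> nat \<Rightarrow> nat" where
  "skey S v s \<equiv> sdist S v s * n + s"

text \<open>Position of \<open>s\<close> in the lexicographic list of the true entries of
  \<open>v\<close>; it bounds how long the entry of \<open>s\<close> waits for smaller ones.\<close>

definition rank :: "nat set \<Rightarrow> nat \<Rightarrow> nat \<Rightarrow> nat" where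
  "rank S v s = card {s'. s' < n \<and> skey S v s' \<le> skey S v s}"

lemma sdist_le: "v < n \<Longrightarrow> s < n \<Longrightarrow> sdist S v s \<le> n"
  unfolding sdist_def using dist_less[of s v] by auto

lemma sdist_edge: "E u v \<Longrightarrow> s < n \<Longrightarrow> sdist S v s \<le> Suc (sdist S u s)"
  unfolding sdist_def using dist_edge by auto

text \<open>Finite estimates come from actual walks starting at sources, so they never undercut the
  distance.\<close>

lemma sdist_le_est: 
  assumes "v < n" "s < n"
  shows "sdist S v s \<le> est S t v s"
proof (cases "est S t v s < n")
  case True
  have "sdist S v s \<le> est S t v s" using assms True
  proof (induction t arbitrary: v rule: less_induct)
    case (less t)
    show ?case using less.prems(3)
    proof (cases rule: estimate_cases)
      case own
      then show ?thesis by (simp add: sdist_def)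
    next
      case (neighbour d u)
      then have "d < n" "E u v" using less.prems nbs_iff by auto
      obtain t' where "t' < t" "est S t' u s = d"
        using sentD[OF neighbour(2) assms(2) \<open>d < n\<close>] by blast
      then have "sdist S u s \<le> d" using less.IH[of t' u] \<open>d < n\<close> E_less \<open>E u v\<close> assms by auto
      then show ?thesis using neighbour(3) sdist_edge[OF \<open>E u v\<close> assms(2), of S] by simp
    qed
  qed
  then show ?thesis .
next
  case False
  then show ?thesis using sdist_le[OF assms, of S] by linarith
qed

text \<open>From \<open>u\<close> to \<open>v\<close> the distance of \<open>s\<close> grows by
  exactly 1 and that of any other source by at most 1, so whatever precedes \<open>s\<close> at
  \<open>u\<close> still precedes it at \<open>v\<close>.\<close>

lemma rank_edge:
  assumes "E u v" "s < n" "sdist S v s = Suc (sdist S u s)"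
  shows "rank S u s \<le> rank S v s"
  unfolding rank_def
proof (rule card_mono)
  show "{s'. s' < n \<and> skey S u s' \<le> skey S u s} \<subseteq> {s'. s' < n \<and> skey S v s' \<le> skey S v s}"
  proof (intro Collect_mono impI conjI)
    fix s' assume s': "s' < n \<and> skey S u s' \<le> skey S u s"
    then show "s' < n" by blast
    have "sdist S v s' * n \<le> Suc (sdist S u s') * n"
      using sdist_edge[OF assms(1)] s' mult_le_mono1 by blast
    then have "sdist S v s' * n \<le> n + sdist S u s' * n" by simp
    moreover have "sdist S v s * n = n + sdist S u s * n" using assms(3) by simp
    ultimately show "skey S v s' \<le> skey S v s" using s' by linarith
  qed
qed simp

lemma rank_less:
  assumes "s < n" "s' < n" "skey S v s' < skey S v s"
  shows "rank S v s' < rank S v s"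
  unfolding rank_def
proof (rule psubset_card_mono)
  let ?A = "\<lambda>s. {t. t < n \<and> skey S v t \<le> skey S v s}"
  have "?A s' \<subseteq> ?A s" using assms(3) by (intro Collect_mono) linarith
  moreover have "s \<in> ?A s - ?A s'" using assms(1,3) by (simp add: not_le)
  ultimately show "?A s' \<subset> ?A s" by blast
qed simp

text \<open>The pipelining argument of Lenzen and Peleg: wrong entries are never smaller than the true entry
  of the same source, so they cannot delay entries that are due.\<close>

lemma sent_skey:
  assumes "v < n" "s < n" "sdist S v s < n" "sdist S v s + rank S v s \<le> t"
  shows "skey S v s \<in> sent S t v"
  using assms
proof (induction t arbitrary: v s)
  case 0
  have "s \<in> {s'. s' < n \<and> skey S v s' \<le> skey S v s}" using 0 by simp
  then have "rank S v s > 0" unfolding rank_def by (intro card_gt_0_iff[THEN iffD2]) auto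
  then show ?case using 0 by simp
next
  case (Suc t)
  \<comment> \<open>The predecessor on a shortest path has distance one less and rank no larger, so
    its entry was due by round \<open>t\<close> and the estimate of \<open>v\<close> is already
    exact.\<close>
  have known: "est S t v s = sdist S v s"
  proof (rule antisym)
    show "sdist S v s \<le> est S t v s" using sdist_le_est Suc.prems by blast
    show "est S t v s \<le> sdist S v s"
    proof (cases "s \<in> S")
      case False
      then show ?thesis using estimate_le by (simp add: sdist_def)
    next
      case True
      show ?thesis
      proof (cases "sdist S v s")
        case 0
        then have "s = v" using dist_eq_0 Suc.prems True by (auto simp: sdist_def)
        then show ?thesis using estimate_own True by simp
      next
        case (Suc d)
        then obtain u where u: "E u v" "sdist S u s = d"
          using dist_pred[of s v d] Suc.prems True by (auto simp: sdist_def)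
        have "rank S u s \<le> rank S v s" using rank_edge u Suc Suc.prems by auto
        then have "skey S u s \<in> sent S t u"
          using Suc.IH[of u s] u E_less Suc Suc.prems by auto
        then show ?thesis using estimate_neighbour[of u "nbs v"] u Suc nbs_iff by auto
      qed
    qed
  qed
  show ?case
  proof (cases "skey S v s \<in> sent S t v")
    case False
    have le: "next_key n (nbs v) v (v \<in> S) (sent S t) \<le> skey S v s"
      using next_key_le_estimate[of s n "nbs v" v "v \<in> S" "sent S t"] False Suc.prems known by simp
    have "next_key n (nbs v) v (v \<in> S) (sent S t) = skey S v s"
    proof (cases rule: next_key_cases[of n "nbs v" v "v \<in> S" "sent S t"])
      case idle
      have "Suc (sdist S v s) * n \<le> n * n" using Suc.prems(3) by (intro mult_le_mono1) simp
      then show ?thesis using idle le Suc.prems(2) by simp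
    next
      case (entry s')
      have "sdist S v s' \<le> est S t v s'" using sdist_le_est entry Suc.prems by blast
      then have le': "skey S v s' \<le> est S t v s' * n + s'" by simp
      show ?thesis
      proof (rule ccontr)
        \<comment> \<open>If a smaller key of \<open>s'\<close> were sent instead, the true key of
          \<open>s'\<close> would be smaller than that of \<open>s\<close>, hence due and already
          sent; then the estimate of \<open>s'\<close> is exact and its key is not unsent.\<close>
        assume "next_key n (nbs v) v (v \<in> S) (sent S t) \<noteq> skey S v s"
        with le have "next_key n (nbs v) v (v \<in> S) (sent S t) < skey S v s" by (rule le_neq_trans)
        with le' entry(2) have lt: "skey S v s' < skey S v s" by linarith
        have "rank S v s' < rank S v s" using rank_less entry(1) Suc.prems(2) lt by blast
        moreover have "sdist S v s' \<le> sdist S v s"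
          using key_le_dist less_imp_le[OF lt] Suc.prems(2) by blast
        ultimately have in': "skey S v s' \<in> sent S t v"
          using Suc.IH[of v s'] entry(1) Suc.prems by linarith
        have "est S t v s' \<le> sdist S v s'"
          using est_le_sent[OF in' entry(1)] key_le_dist less_imp_le[OF lt] Suc.prems(2,3)
          by (meson le_less_trans)
        then have "est S t v s' = sdist S v s'" using sdist_le_est entry Suc.prems le_antisym by blast
        then show False using in' entry by simp
      qed
    qed
    then show ?thesis by (simp add: sent.simps(2))
  qed (simp add: sent.simps(2))
qed

end

section \<open>Candidate edges and flooding\<close>

text \<open>Two reports of the same source by distinct neighbours, joined at \<open>v\<close>. The
  comparison with the estimate of \<open>v\<close> itself is what lets
  \<open>sent_walk_avoiding\<close> conclude that neither walk visits \<open>v\<close>.\<close>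

definition candidates :: "nat \<Rightarrow> nat set \<Rightarrow> nat \<Rightarrow> bool \<Rightarrow> (nat \<Rightarrow> nat set) \<Rightarrow> (nat \<times> nat) set" where
  "candidates n N v b H = {(a + a' + 2, w) |a a' w. \<exists>w' s. s < n \<and> a < n \<and> a' < n \<and>
     w \<in> N \<and> w' \<in> N \<and> w \<noteq> w' \<and> a * n + s \<in> H w \<and> a' * n + s \<in> H w' \<and>
     a \<le> estimate n N v b H s \<and> a' \<le> estimate n N v b H s}"

lemma candidatesI:
  assumes "w \<in> N" "w' \<in> N" "w \<noteq> w'" "s < n" "a < n" "a' < n"
    "a * n + s \<in> H w" "a' * n + s \<in> H w'"
    "a \<le> estimate n N v b H s" "a' \<le> estimate n N v b H s"
  shows "(a + a' + 2, w) \<in> candidates n N v b H"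
  unfolding candidates_def using assms by blast

lemma candidates_cong:
  assumes "\<And>u. u \<in> N \<Longrightarrow> H u = H' u"
  shows "candidates n N v b H = candidates n N v b H'"
proof -
  have "estimate n N v b H s = estimate n N v b H' s" for s
    using assms by (rule estimate_cong)
  then show ?thesis using assms unfolding candidates_def by (simp cong: conj_cong)
qed

text \<open>A min-plus step: \<open>c = 0\<close> broadcasts a minimum, \<open>c = 1\<close>
  performs breadth-first search.\<close>

definition flood_step :: "nat \<Rightarrow> nat set \<Rightarrow> nat \<Rightarrow> (nat \<Rightarrow> nat) \<Rightarrow> nat" where
  "flood_step c N v M = Inf ((\<lambda>u. M u + (if u = v then 0 else c)) ` insert v N)"

fun flood :: "nat \<Rightarrow> (nat \<Rightarrow> nat set) \<Rightarrow> (nat \<Rightarrow> nat) \<Rightarrow> nat \<Rightarrow> nat \<Rightarrow> nat" where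
  "flood c N x 0 v = x v"
| "flood c N x (Suc t) v = flood_step c (N v) v (flood c N x t)"

lemma flood_step_cong:
  "(\<And>u. u \<in> insert v N \<Longrightarrow> M u = M' u) \<Longrightarrow> flood_step c N v M = flood_step c N v M'"
  unfolding flood_step_def by (intro arg_cong[where f = Inf] image_cong) auto

lemma flood_step_le: "u \<in> insert v N \<Longrightarrow> flood_step c N v M \<le> M u + (if u = v then 0 else c)"
  unfolding flood_step_def by (intro wellorder_Inf_le1) blast

lemma flood_step_attained:
  obtains u where "u \<in> insert v N" "flood_step c N v M = M u + (if u = v then 0 else c)"
proof -
  have "flood_step c N v M \<in> (\<lambda>u. M u + (if u = v then 0 else c)) ` insert v N"
    unfolding flood_step_def
    by (intro wellorder_InfI[of "M v + (if v = v then 0 else c)"] imageI) simp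
  then show ?thesis using that by blast
qed

lemma flood_cong:
  assumes "\<And>v. v \<in> A \<Longrightarrow> x v = x' v" "\<And>v. v \<in> A \<Longrightarrow> N v = N' v" "\<And>v. v \<in> A \<Longrightarrow> N v \<subseteq> A"
  shows "v \<in> A \<Longrightarrow> flood c N x t v = flood c N' x' t v"
proof (induction t arbitrary: v)
  case (Suc t)
  have "flood_step c (N v) v (flood c N x t) = flood_step c (N v) v (flood c N' x' t)"
    by (rule flood_step_cong) (use Suc assms in blast)
  then show ?case using assms Suc.prems by simp
qed (use assms in simp)

lemma flood_decreasing: "flood c N x t v \<le> x v"
proof (induction t)
  case (Suc t)
  have "flood c N x (Suc t) v \<le> flood c N x t v"
    using flood_step_le[of v v "N v" c "flood c N x t"] by simp
  then show ?case using Suc by linarith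
qed simp

text \<open>Together with \<open>flood_attained\<close> this identifies the flooded value as the
  minimum of \<open>x u + c * j\<close> over all walks of length \<open>j \<le> t\<close> from some
  \<open>u\<close> to \<open>v\<close>.\<close>

lemma flood_le:
  assumes N: "\<And>u v. R u v \<Longrightarrow> u \<in> N v"
  shows "(R ^^ j) u v \<Longrightarrow> j \<le> t \<Longrightarrow> flood c N x t v \<le> x u + c * j"
proof (induction t arbitrary: j v)
  case (Suc t)
  show ?case
  proof (cases j)
    case 0
    then have "u = v" using Suc.prems by simp
    then show ?thesis using flood_decreasing[of c N x "Suc t" v] 0 by simp
  next
    case (Suc i)
    then obtain w where w: "(R ^^ i) u w" "R w v" using Suc.prems by auto
    then have IH: "flood c N x t w \<le> x u + c * i" using Suc.IH Suc.prems Suc by simp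
    have "flood c N x (Suc t) v \<le> flood c N x t w + (if w = v then 0 else c)"
      using flood_step_le[of w v "N v"] N[OF w(2)] by simp
    also have "\<dots> \<le> flood c N x t w + c" by simp
    finally show ?thesis using IH Suc by simp
  qed
qed auto

lemma flood_attained:
  assumes N: "\<And>u v. u \<in> N v \<Longrightarrow> R u v"
  shows "\<exists>u j. j \<le> t \<and> (R ^^ j) u v \<and> flood c N x t v = x u + c * j"
proof (induction t arbitrary: v)
  case 0
  then show ?case by (intro exI[of _ v] exI[of _ 0]) simp
next
  case (Suc t)
  obtain w where w: "w \<in> insert v (N v)"
      "flood_step c (N v) v (flood c N x t) = flood c N x t w + (if w = v then 0 else c)"
    by (rule flood_step_attained)
  obtain u j where uj: "j \<le> t" "(R ^^ j) u w" "flood c N x t w = x u + c * j" using Suc.IH by blast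
  show ?case
  proof (cases "w = v")
    case True
    then show ?thesis using uj w by (intro exI[of _ u] exI[of _ j]) simp
  next
    case False
    then have "R w v" using w N by blast
    then have "(R ^^ Suc j) u v" using uj by auto
    then show ?thesis using uj w False by (intro exI[of _ u] exI[of _ "Suc j"]) simp
  qed
qed

section \<open>Candidate edges lie on cycles, and light ones exist\<close>

context network
begin

lemma relpowp_less: assumes "(E ^^ j) u v" "v < n" shows "u < n"
proof (cases j)
  case (Suc k)
  then obtain w where "E u w" using assms(1) by (metis relpowp_Suc_E2)
  then show ?thesis using E_less by blast
qed (use assms in simp)

lemma cycle_less: assumes "is_cycle E xs" "x \<in> set xs" shows "x < n"
proof -
  obtain i where i: "i < length xs" "xs ! i = x" using assms(2) by (auto simp: in_set_conv_nth)
  have "xs \<noteq> []" using assms(2) by auto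
  show ?thesis
  proof (cases "Suc i < length xs")
    case True
    then show ?thesis using assms(1) i E_less unfolding is_cycle_def is_walk_def by blast
  next
    case False
    then have "i = length xs - 1" using i by simp
    then have "x = last xs" using i \<open>xs \<noteq> []\<close> by (simp add: last_conv_nth)
    then show ?thesis using assms(1) E_less unfolding is_cycle_def by blast
  qed
qed

text \<open>Both walks avoid \<open>u\<close>, hence also the edge to \<open>w\<close>; joined at
  \<open>s\<close> and preceded by the step from \<open>u\<close> to \<open>w'\<close> they form the
  detour.\<close>

lemma candidate_sound:
  assumes "(W, w) \<in> candidates n (nbs u) u (u \<in> S) (sent S t)"
  shows "E u w \<and> (delete_edge E u w ^^ (W - 1)) u w"
proof -
  obtain a a' w' s where c: "W = a + a' + 2" "s < n" "a < n" "a' < n" "E w u" "E w' u" "w \<noteq> w'"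
      "a * n + s \<in> sent S t w" "a' * n + s \<in> sent S t w'" "a \<le> est S t u s" "a' \<le> est S t u s"
    using assms unfolding candidates_def nbs_iff by blast
  have ne: "u \<noteq> w" "u \<noteq> w'" using c E_irrefl by auto
  have "(avoiding u ^^ a) s w" using sent_walk_avoiding[OF c(8,2,3) ne(1)] c(10) by simp
  moreover have "(avoiding u ^^ a') s w'" using sent_walk_avoiding[OF c(9,2,4) ne(2)] c(11) by simp
  then have "(avoiding u ^^ a') w' s"
    by (rule relpowp_sym[rotated]) (use E_sym in \<open>auto simp: avoiding_def\<close>)
  ultimately have "(avoiding u ^^ (a' + a)) w' w" by (auto simp: relpowp_add)
  then have "(delete_edge E u w ^^ (a' + a)) w' w"
    by (rule relpowp_mono[rotated]) (auto simp: avoiding_def delete_edge_def)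
  \<comment> \<open>Here \<open>w \<noteq> w'\<close> enters: the first step does not use the
    deleted edge.\<close>
  moreover have "delete_edge E u w u w'" using c E_sym ne by (auto simp: delete_edge_def)
  ultimately have "(delete_edge E u w ^^ Suc (a' + a)) u w" by (intro relpowp_Suc_I2)
  then show ?thesis using c E_sym by (simp add: add.commute)
qed

text \<open>Entries have to be known only at cycle vertices close to the source, which is why small
  balls of bounded radius suffice. The bound by the diameter is what later limits the search to
  \<open>4 * h + 1\<close> rounds.\<close>

lemma candidate_exists:
  assumes cyc: "is_cycle E xs" and x: "x \<in> set xs" and s: "s < n" "s \<in> S" and d: "dist s x \<le> d"
    and known: "\<And>y. y \<in> set xs \<Longrightarrow> 2 * dist s y + 1 \<le> 2 * d + length xs
      \<Longrightarrow> dist s y * n + s \<in> sent S t y"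
  shows "\<exists>u<n. \<exists>W w. (W, w) \<in> candidates n (nbs u) u (u \<in> S) (sent S t) \<and>
    W \<le> 2 * d + length xs \<and> W \<le> 2 * hop_diameter n E + 1"
proof (rule cycle_level_edge_or_peak[where f = "dist s", OF cyc x d], goal_cases)
  case 1
  then show ?case by (rule E_sym)
next
  case 2
  then show ?case using s(1) by (rule dist_edge)
next
  case level: (3 u v)
  have un: "u < n" "v < n" using E_less level(3) by blast+
  have low: "dist s y \<le> est S t y s" if "y < n" for y
    using sdist_le_est[OF that s(1), of S t] s(2) by (simp add: sdist_def)
  have "dist s u * n + s \<in> sent S t u" using known level by blast
  then have est: "est S t u s = dist s u"
    using est_le_sent low un s dist_less[OF s(1) un(1)] le_antisym by blast
  have "dist s u \<noteq> 0"
  proof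
    assume "dist s u = 0"
    then have "s = u" "s = v" using level(4) dist_eq_0[OF s(1)] un by simp_all
    then show False using level(3) E_irrefl by blast
  qed
  then have nz: "est S t u s \<noteq> 0" using est by simp
  have "est S t u s < n" using est dist_less s un by simp
  \<comment> \<open>On a level edge one reporting neighbour is \<open>v\<close>; the other is the
    neighbour from which \<open>u\<close> learnt its own distance. It differs from \<open>v\<close>
    because it reported less than the distance of \<open>v\<close>.\<close>
  then obtain a w where w: "w \<in> nbs u" "a * n + s \<in> sent S t w" "dist s u = Suc a"
    by (rule estimate_cases) (use est nz in auto)
  have an: "a < n" using w(3) dist_less[OF s(1) un(1)] by simp
  have "w \<noteq> v"
  proof
    assume "w = v"
    then have "est S t v s \<le> a" using est_le_sent w(2) s an by blast
    then show False using low[OF un(2)] level(4) w(3) by simp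
  qed
  then have "v \<noteq> w" by blast
  moreover have "v \<in> nbs u" using level(3) E_sym nbs_iff by blast
  moreover have "dist s v * n + s \<in> sent S t v" using known level by simp
  moreover have "dist s v \<le> est S t u s" "a \<le> est S t u s" using est level(4) w(3) by simp_all
  ultimately have "(dist s v + a + 2, v) \<in> candidates n (nbs u) u (u \<in> S) (sent S t)"
    using w(1,2) s(1) an dist_less[OF s(1) un(2)] by (intro candidatesI)
  moreover have "dist s u \<le> hop_diameter n E" using dist_le_diameter s un by blast
  then have "dist s v + a + 2 \<le> 2 * d + length xs" "dist s v + a + 2 \<le> 2 * hop_diameter n E + 1"
    using level(4,5) w(3) by simp_all
  ultimately show ?thesis using un by blast
next
  case peak: (4 u v w)
  have un: "u < n" "v < n" "w < n" using E_less peak(4,5) by blast+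
  have low: "dist s u \<le> est S t u s"
    using sdist_le_est[OF un(1) s(1), of S t] s(2) by (simp add: sdist_def)
  have "dist s v * n + s \<in> sent S t v" "dist s w * n + s \<in> sent S t w"
    using known[of v] known[of w] peak by simp_all
  moreover have "v \<in> nbs u" "w \<in> nbs u" using peak(4,5) E_sym nbs_iff by blast+
  moreover have "dist s v \<le> est S t u s" "dist s w \<le> est S t u s" using low peak(7,8) by simp_all
  ultimately have "(dist s v + dist s w + 2, v) \<in> candidates n (nbs u) u (u \<in> S) (sent S t)"
    using peak(6) s(1) dist_less[OF s(1) un(2)] dist_less[OF s(1) un(3)] by (intro candidatesI)
  moreover have "dist s u \<le> hop_diameter n E" using dist_le_diameter s un by blast
  then have "dist s v + dist s w + 2 \<le> 2 * d + length xs"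
    "dist s v + dist s w + 2 \<le> 2 * hop_diameter n E + 1"
    using peak(7-9) by simp_all
  ultimately show ?thesis using un by blast
qed

text \<open>Sources that precede \<open>s\<close> at \<open>v\<close> are no farther from
  \<open>v\<close>, so a small ball or a small source set means a short wait.\<close>

lemma rank_le_ball:
  assumes "v < n" "s < n" "s \<in> S"
  shows "rank S v s \<le> card {y. y < n \<and> y \<in> S \<and> dist v y \<le> dist v s}"
  unfolding rank_def
proof (rule card_mono)
  show "{s'. s' < n \<and> skey S v s' \<le> skey S v s}
    \<subseteq> {y. y < n \<and> y \<in> S \<and> dist v y \<le> dist v s}"
  proof (rule Collect_mono, rule impI)
    fix y assume y: "y < n \<and> skey S v y \<le> skey S v s"
    then have "sdist S v y \<le> sdist S v s" using key_le_dist assms(2) by blast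
    moreover have "sdist S v s < n" using assms dist_less by (simp add: sdist_def)
    ultimately have "y \<in> S" "dist y v \<le> dist s v"
      using assms(3) by (auto simp: sdist_def split: if_splits)
    then show "y < n \<and> y \<in> S \<and> dist v y \<le> dist v s"
      using y dist_sym[of y v] dist_sym[of s v] assms by simp
  qed
qed simp

lemma flood_broadcast:
  assumes "v < n" "hop_diameter n E \<le> t"
  shows "flood 0 nbs x t v = Inf (x ` {..<n})"
proof (rule antisym)
  obtain u j where u: "(E ^^ j) u v" "flood 0 nbs x t v = x u + 0 * j"
    using flood_attained[of nbs E t v 0 x] nbs_iff by blast
  then have "u < n" using relpowp_less assms by blast
  then show "Inf (x ` {..<n}) \<le> flood 0 nbs x t v"
    unfolding u(2) by (simp add: wellorder_Inf_le1)
  have "Inf (x ` {..<n}) \<in> x ` {..<n}" using assms by (intro wellorder_InfI[of "x v"]) auto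
  then obtain w where w: "w < n" "Inf (x ` {..<n}) = x w" by auto
  have "dist w v \<le> t" using dist_le_diameter[OF w(1) assms(1)] assms(2) by simp
  then show "flood 0 nbs x t v \<le> Inf (x ` {..<n})"
    using flood_le[of E nbs "dist w v" w v t 0 x] nbs_iff dist_walk[OF w(1) assms(1)] w(2) by simp
qed

end

section \<open>Correctness of one phase\<close>

text \<open>Weight and end points of a candidate edge packed into one number, compared by weight first;
  \<open>0\<close> is reserved for failure and \<^term>\<open>no_key n\<close> exceeds the keys of all candidates.\<close>

definition edge_key :: "nat \<Rightarrow> nat \<Rightarrow> nat \<Rightarrow> nat \<Rightarrow> nat" where
  "edge_key n W u w = (W * n + u) * n + w + 1"

definition no_key :: "nat \<Rightarrow> nat" where
  "no_key n = 4 * (n * n * n)"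

definition key_weight :: "nat \<Rightarrow> nat \<Rightarrow> nat" where
  "key_weight n k = (k - 1) div n div n"

definition key_tail :: "nat \<Rightarrow> nat \<Rightarrow> nat" where
  "key_tail n k = (k - 1) div n mod n"

definition key_head :: "nat \<Rightarrow> nat \<Rightarrow> nat" where
  "key_head n k = (k - 1) mod n"

text \<open>The value 0 is the veto: being below every edge key, it wins wherever the flood carries
  it. In the first detection every node is a source, hence the flag \<open>True\<close>.\<close>

definition local_key ::
  "nat \<Rightarrow> nat set \<Rightarrow> nat \<Rightarrow> bool \<Rightarrow> nat \<Rightarrow> (nat \<Rightarrow> nat set) \<Rightarrow> (nat \<Rightarrow> nat set) \<Rightarrow> nat" where
  "local_key n N v b h H H' = (if h < estimate n N v b H' 0 then 0
     else Inf (insert (no_key n) ((\<lambda>(W, w). edge_key n W v w) `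
       (candidates n N v True H \<union> candidates n N v b H'))))"

definition cut_nbs :: "nat \<Rightarrow> nat \<Rightarrow> nat set \<Rightarrow> nat \<Rightarrow> nat set" where
  "cut_nbs n k N v = {u \<in> N. \<not> (v = key_tail n k \<and> u = key_head n k) \<and>
     \<not> (v = key_head n k \<and> u = key_tail n k)}"

definition bfs_start :: "nat \<Rightarrow> nat \<Rightarrow> nat \<Rightarrow> nat" where
  "bfs_start n k v = (if v = key_tail n k then 0 else n)"

text \<open>The search starts at the tail, so the head reads off the length of the detour, and
  \<open>Suc\<close> counts the deleted edge. All other nodes offer \<open>Suc n\<close>, above any
  cycle length, so the minimum selects the value of the head.\<close>

definition out_start :: "nat \<Rightarrow> nat \<Rightarrow> nat \<Rightarrow> nat \<Rightarrow> nat" where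
  "out_start n k y v = (if v = key_head n k then Suc y else Suc n)"

lemma edge_key_decode:
  assumes "u < n" "w < n"
  shows "key_weight n (edge_key n W u w) = W" "key_tail n (edge_key n W u w) = u"
    "key_head n (edge_key n W u w) = w"
  using assms by (simp_all add: edge_key_def key_weight_def key_tail_def key_head_def)

lemma key_weight_mono: "k \<le> k' \<Longrightarrow> key_weight n k \<le> key_weight n k'"
  unfolding key_weight_def by (intro div_le_mono diff_le_mono)

lemma candidates_weight_less: "(W, w) \<in> candidates n N v b H \<Longrightarrow> W \<le> 2 * n \<and> w \<in> N"
  unfolding candidates_def by auto

lemma edge_key_less:
  assumes "W \<le> 2 * n" "u < n" "w < n"
  shows "edge_key n W u w < no_key n"
proof -
  have "W * n + u < (2 * n + 1) * n"
  proof -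
    have "W * n \<le> 2 * n * n" using assms(1) by (rule mult_le_mono1)
    moreover have "(2 * n + 1) * n = 2 * n * n + n" by simp
    ultimately show ?thesis using assms(2) by linarith
  qed
  then have "Suc (W * n + u) \<le> (2 * n + 1) * n" by simp
  then have "Suc (W * n + u) * n \<le> (2 * n + 1) * n * n" by (rule mult_le_mono1)
  moreover have "(2 * n + 1) * n * n \<le> 3 * n * n * n"
    using assms(2) by (intro mult_le_mono1) simp
  moreover have "edge_key n W u w \<le> Suc (W * n + u) * n"
    using assms(3) by (simp add: edge_key_def)
  moreover have "3 * n * n * n < no_key n" using assms(2) by (simp add: no_key_def)
  ultimately show ?thesis by linarith
qed

lemma local_key_cong:
  assumes "\<And>u. u \<in> N \<Longrightarrow> H u = K u" "\<And>u. u \<in> N \<Longrightarrow> H' u = K' u"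
  shows "local_key n N v b h H H' = local_key n N v b h K K'"
proof -
  have "candidates n N v True H = candidates n N v True K"
    "candidates n N v b H' = candidates n N v b K'"
    "estimate n N v b H' 0 = estimate n N v b K' 0"
    by (rule candidates_cong estimate_cong; use assms in blast)+
  then show ?thesis unfolding local_key_def by simp
qed

lemma local_key_le: "local_key n N v b h H H' \<le> no_key n"
  unfolding local_key_def by (auto intro: wellorder_Inf_le1)

lemma local_key_nonzero:
  assumes "0 < n" "estimate n N v b H' 0 \<le> h"
  shows "local_key n N v b h H H' \<noteq> 0"
proof -
  let ?A = "insert (no_key n) ((\<lambda>(W, w). edge_key n W v w) `
       (candidates n N v True H \<union> candidates n N v b H'))"
  have "Inf ?A \<in> ?A" by (intro wellorder_InfI[of "no_key n"]) simp
  moreover have "0 \<notin> ?A" using assms(1) by (auto simp: no_key_def edge_key_def)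
  ultimately have "Inf ?A \<noteq> 0" by metis
  then show ?thesis using assms(2) by (simp add: local_key_def)
qed

lemma local_key_le_candidate:
  assumes "(W, w) \<in> candidates n N v True H \<union> candidates n N v b H'"
  shows "local_key n N v b h H H' \<le> edge_key n W v w"
proof -
  have "edge_key n W v w \<in> insert (no_key n) ((\<lambda>(W, w). edge_key n W v w) `
       (candidates n N v True H \<union> candidates n N v b H'))"
    using assms by force
  then show ?thesis unfolding local_key_def by (simp add: wellorder_Inf_le1)
qed

lemma local_key_candidate:
  assumes "local_key n N v b h H H' \<noteq> 0" "local_key n N v b h H H' \<noteq> no_key n"
  obtains W w where "(W, w) \<in> candidates n N v True H \<union> candidates n N v b H'"
    "local_key n N v b h H H' = edge_key n W v w"
proof -
  let ?A = "insert (no_key n) ((\<lambda>(W, w). edge_key n W v w) `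
       (candidates n N v True H \<union> candidates n N v b H'))"
  have "Inf ?A \<in> ?A" by (intro wellorder_InfI[of "no_key n"]) simp
  moreover have "local_key n N v b h H H' = Inf ?A"
    using assms(1) by (simp add: local_key_def split: if_splits)
  ultimately show ?thesis using that assms(2) by auto
qed

lemma local_key_nonzeroD: "local_key n N v b h H H' \<noteq> 0 \<Longrightarrow> estimate n N v b H' 0 \<le> h"
  unfolding local_key_def by (simp split: if_splits)

text \<open>Nothing here relates \<open>h\<close> to the diameter: a phase is run for every guess,
  and \<open>diameter_le\<close> recovers the relation from a successful outcome. One
  \<open>K\<close> bounds both the number of sources and the size of a small ball, since either
  limits a waiting time.\<close>

locale phase = network +
  fixes S :: "nat set" and h K :: nat and xs :: "nat list"
  assumes zero_S: "0 \<in> S" and S_less: "S \<subseteq> {..<n}" and card_S: "card S \<le> K"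
    and cyc: "is_cycle E xs" and shortest: "length xs = girth E"
    and hit: "(\<forall>x\<in>set xs. card {y. y < n \<and> dist x y \<le> (girth E - 1) div 2} \<le> K) \<or>
      (\<exists>x\<in>set xs. \<exists>s\<in>S. dist s x \<le> (girth E - 1) div 2)"
begin

text \<open>Rank at most \<open>K\<close> plus distance at most \<open>2 * h\<close>: the time by
  which \<open>sent_skey\<close> guarantees an entry.\<close>

definition rounds where "rounds = K + 2 * h"

definition X0 where
  "X0 v = local_key n (nbs v) v (v \<in> S) h (sent {..<n} rounds) (sent S rounds)"

definition X where "X t = flood 0 nbs X0 t"

definition key where "key v = X (2 * h + 1) v"

text \<open>Each node cuts the edge named by its own key; only a successful election makes this the
  same edge everywhere.\<close>

definition Y where
  "Y t = flood 1 (\<lambda>v. cut_nbs n (key v) (nbs v) v) (\<lambda>v. bfs_start n (key v) v) t"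

definition Z where
  "Z t = flood 0 nbs (\<lambda>v. out_start n (key v) (Y (4 * h + 1) v) v) t"

lemma n_pos: "0 < n" using zero_S S_less by auto

lemma sent_due:
  assumes "v < n" "s < n" "s \<in> A" "A \<subseteq> {..<n}" "dist s v \<le> 2 * h"
    and "card {y. y < n \<and> y \<in> A \<and> dist v y \<le> dist v s} \<le> K"
  shows "dist s v * n + s \<in> sent A rounds v"
proof -
  have "rank A v s \<le> K" using rank_le_ball[OF assms(1-3)] assms(6) by simp
  then have "sdist A v s + rank A v s \<le> rounds" using assms(3,5) by (simp add: sdist_def rounds_def)
  then show ?thesis
    using sent_skey[OF assms(1,2), of A rounds] dist_less[OF assms(2,1)] assms(3)
    by (simp add: sdist_def)
qed

text \<open>Node 0 is one of at most \<open>K\<close> sources, so if \<open>h\<close> is large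
  enough its entry reaches every node in time and nobody vetoes.\<close>

lemma key_nonzeroI:
  assumes "\<And>v. v < n \<Longrightarrow> dist 0 v \<le> h" "v < n"
  shows "key v \<noteq> 0"
proof -
  have X0: "X0 u \<noteq> 0" if u: "u < n" for u
  proof -
    have "card {y. y < n \<and> y \<in> S \<and> dist u y \<le> dist u 0} \<le> card S"
      using S_less finite_subset[OF S_less] by (intro card_mono) auto
    then have "dist 0 u * n + 0 \<in> sent S rounds u"
      using sent_due[OF u n_pos zero_S S_less] assms(1)[OF u] card_S by simp
    then have "est S rounds u 0 \<le> dist 0 u"
      using est_le_sent n_pos dist_less[OF n_pos u] by blast
    then show ?thesis
      unfolding X0_def using assms(1)[OF u] by (intro local_key_nonzero n_pos) simp
  qed
  obtain u j where u: "(E ^^ j) u v" "key v = X0 u + 0 * j"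
    using flood_attained[of nbs E "2 * h + 1" v 0 X0] nbs_iff unfolding key_def X_def by blast
  then have "u < n" using relpowp_less assms(2) by blast
  then show ?thesis using X0 u(2) by simp
qed

text \<open>Flooding only decreases values, so a nonzero key shows that the node itself did not veto
  and lies within \<open>h\<close> of node 0; any two nodes are then joined through node 0.\<close>

lemma diameter_le:
  assumes "\<And>v. v < n \<Longrightarrow> key v \<noteq> 0"
  shows "hop_diameter n E \<le> 2 * h"
proof -
  have h: "dist 0 v \<le> h" if v: "v < n" for v
  proof -
    have "key v \<le> X0 v" unfolding key_def X_def by (rule flood_decreasing)
    then have "X0 v \<noteq> 0" using assms[OF v] by simp
    then have "est S rounds v 0 \<le> h" unfolding X0_def by (rule local_key_nonzeroD)
    then show ?thesis
      using sdist_le_est[OF v n_pos, of S rounds] zero_S by (simp add: sdist_def)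
  qed
  obtain u v where uv: "u < n" "v < n" "hop_diameter n E = dist u v"
    using diameter_attained[OF n_pos] by blast
  then show ?thesis
    using dist_triangle[OF uv(1) n_pos uv(2)] dist_sym[OF uv(1) n_pos] h[OF uv(1)] h[OF uv(2)]
    by linarith
qed

lemma girth_pos: "girth E \<ge> 3"
  using cyc shortest unfolding is_cycle_def by simp

lemma light_candidate:
  assumes diam: "hop_diameter n E \<le> 2 * h"
  shows "\<exists>u<n. \<exists>W w. (W, w) \<in> candidates n (nbs u) u True (sent {..<n} rounds) \<union>
      candidates n (nbs u) u (u \<in> S) (sent S rounds) \<and> W \<le> 2 * girth E - 1 \<and> W \<le> 4 * h + 1"
  using hit
proof
  define m where "m = (girth E - 1) div 2"
  assume small: "\<forall>x\<in>set xs. card {y. y < n \<and> dist x y \<le> (girth E - 1) div 2} \<le> K"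
  obtain x where x: "x \<in> set xs" using cyc unfolding is_cycle_def by (cases xs) auto
  then have xn: "x < n" using cycle_less cyc by blast
  \<comment> \<open>The source is the cycle vertex \<open>x\<close> itself, hence the offset
    0.\<close>
  have "\<exists>u<n. \<exists>W w. (W, w) \<in> candidates n (nbs u) u (u \<in> {..<n}) (sent {..<n} rounds) \<and>
    W \<le> 2 * 0 + length xs \<and> W \<le> 2 * hop_diameter n E + 1"
  proof (rule candidate_exists[OF cyc x xn])
    fix y assume y: "y \<in> set xs" "2 * dist x y + 1 \<le> 2 * 0 + length xs"
    then have yn: "y < n" using cycle_less cyc by blast
    \<comment> \<open>The restriction on \<open>y\<close> keeps it within \<open>m\<close> of the
      source, so the entries waiting ahead belong to the ball of radius \<open>m\<close> around
      \<open>y\<close>.\<close>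
    have "dist y x \<le> m" using y(2) dist_sym[OF xn yn] shortest unfolding m_def by linarith
    then have "card {z. z < n \<and> z \<in> {..<n} \<and> dist y z \<le> dist y x} \<le> card {z. z < n \<and> dist y z \<le> m}"
      by (intro card_mono) auto
    also have "\<dots> \<le> K" using small y(1) unfolding m_def by blast
    finally show "dist x y * n + x \<in> sent {..<n} rounds y"
      using sent_due[OF yn xn, of "{..<n}"] xn dist_le_diameter[OF xn yn] diam by simp
  qed (use xn in simp_all)
  then obtain u W w where "u < n" "(W, w) \<in> candidates n (nbs u) u True (sent {..<n} rounds)"
      "W \<le> length xs" "W \<le> 2 * hop_diameter n E + 1"
    by auto
  moreover have "length xs \<le> 2 * girth E - 1" using shortest girth_pos by linarith
  ultimately show ?thesis using diam
    by (intro exI[of _ u] conjI exI[of _ W] exI[of _ w]) auto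
next
  define m where "m = (girth E - 1) div 2"
  assume "\<exists>x\<in>set xs. \<exists>s\<in>S. dist s x \<le> (girth E - 1) div 2"
  then obtain x s where xs: "x \<in> set xs" "s \<in> S" "dist s x \<le> m" unfolding m_def by blast
  then have sn: "s < n" using S_less by blast
  have "\<exists>u<n. \<exists>W w. (W, w) \<in> candidates n (nbs u) u (u \<in> S) (sent S rounds) \<and>
    W \<le> 2 * m + length xs \<and> W \<le> 2 * hop_diameter n E + 1"
  proof (rule candidate_exists[OF cyc xs(1) sn xs(2,3)])
    fix y assume y: "y \<in> set xs"
    then have yn: "y < n" using cycle_less cyc by blast
    \<comment> \<open>No ball is involved: there are at most \<open>K\<close> sources
      altogether.\<close>
    have "card {z. z < n \<and> z \<in> S \<and> dist y z \<le> dist y s} \<le> card S"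
      using finite_subset[OF S_less] by (intro card_mono) auto
    then show "dist s y * n + s \<in> sent S rounds y"
      using sent_due[OF yn sn xs(2) S_less] dist_le_diameter[OF sn yn] diam card_S by simp
  qed
  then obtain u W w where "u < n" "(W, w) \<in> candidates n (nbs u) u (u \<in> S) (sent S rounds)"
      "W \<le> 2 * m + length xs" "W \<le> 2 * hop_diameter n E + 1"
    by auto
  \<comment> \<open>By rounding, \<open>2 * m \<le> girth E - 1\<close>; this is where the
    \<open>- 1\<close> of the guarantee comes from.\<close>
  moreover have "2 * m + length xs \<le> 2 * girth E - 1"
    using shortest girth_pos unfolding m_def by linarith
  ultimately show ?thesis using diam
    by (intro exI[of _ u] conjI exI[of _ W] exI[of _ w]) auto
qed

theorem phase_correct:
  assumes ok: "\<And>v. v < n \<Longrightarrow> key v \<noteq> 0"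
  shows "\<exists>g'. (\<forall>v<n. Z (2 * h) v = g') \<and> girth E \<le> g' \<and> g' \<le> 2 * girth E - 1 \<and>
    (\<exists>ys. is_cycle E ys \<and> length ys = g')"
proof -
  have diam: "hop_diameter n E \<le> 2 * h" using ok by (rule diameter_le)
  define \<kappa> where "\<kappa> = Inf (X0 ` {..<n})"
  have key: "key v = \<kappa>" if "v < n" for v
    unfolding key_def X_def \<kappa>_def using that diam by (intro flood_broadcast) auto
  have "\<kappa> \<in> X0 ` {..<n}" unfolding \<kappa>_def using n_pos by (intro wellorder_InfI[of "X0 0"]) auto
  then obtain u where u: "u < n" "\<kappa> = X0 u" by blast
  obtain u' W' w' where cand: "u' < n" "(W', w') \<in> candidates n (nbs u') u' True (sent {..<n} rounds) \<union>
      candidates n (nbs u') u' (u' \<in> S) (sent S rounds)" "W' \<le> 2 * girth E - 1" "W' \<le> 4 * h + 1"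
    using light_candidate[OF diam] by blast
  have w': "w' < n" "W' \<le> 2 * n"
    using cand(2) candidates_weight_less E_less nbs_iff by blast+
  have "\<kappa> \<le> X0 u'" unfolding \<kappa>_def using cand(1) by (simp add: wellorder_Inf_le1)
  also have "X0 u' \<le> edge_key n W' u' w'" unfolding X0_def using cand(2) by (rule local_key_le_candidate)
  finally have le: "\<kappa> \<le> edge_key n W' u' w'" .
  then have "\<kappa> < no_key n" using edge_key_less[OF w'(2) cand(1) w'(1)] by simp
  then have nk: "X0 u \<noteq> no_key n" using u(2) by simp
  have nz: "X0 u \<noteq> 0" using ok[OF n_pos] key[OF n_pos] u(2) by simp
  obtain W w where Ww: "(W, w) \<in> candidates n (nbs u) u True (sent {..<n} rounds) \<union>
      candidates n (nbs u) u (u \<in> S) (sent S rounds)" "\<kappa> = edge_key n W u w"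
    using local_key_candidate[OF nz[unfolded X0_def] nk[unfolded X0_def]] u(2) unfolding X0_def by metis
  have "E u w \<and> (delete_edge E u w ^^ (W - 1)) u w"
    using Ww(1) candidate_sound[of W w u "{..<n}" rounds] candidate_sound[of W w u S rounds] u(1)
    by auto
  then have edge: "E u w" and detour: "(delete_edge E u w ^^ (W - 1)) u w" by blast+
  have w: "w < n" using edge E_less by blast
  have dec: "key_tail n \<kappa> = u" "key_head n \<kappa> = w" "key_weight n \<kappa> = W"
    unfolding Ww(2) by (rule edge_key_decode[OF u(1) w])+
  \<comment> \<open>The weight is the leading digit of a key, so the elected edge is at most as
    heavy as the light candidate.\<close>
  have "W \<le> W'" using key_weight_mono[OF le, of n] dec(3) edge_key_decode(1)[OF cand(1) w'(1)] by simp
  \<comment> \<open>\<open>W - 1\<close> is the length of some detour only; the output comes from a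
    shortest one.\<close>
  define k where "k = (LEAST k. (delete_edge E u w ^^ k) u w)"
  have walk: "(delete_edge E u w ^^ k) u w" unfolding k_def using detour by (rule LeastI)
  have least: "\<not> (delete_edge E u w ^^ j) u w" if "j < k" for j
    using that not_less_Least unfolding k_def by blast
  have "k \<le> W - 1" unfolding k_def using detour by (rule Least_le)
  then have k: "k \<le> 4 * h + 1" "Suc k \<le> 2 * girth E - 1"
    using \<open>W \<le> W'\<close> cand(3,4) girth_pos by linarith+
  have "k < n"
    using shortest_walk_less[OF walk least, of n] E_less u(1) by (auto simp: delete_edge_def)
  have Y: "Y (4 * h + 1) w = k"
  proof -
    let ?N = "\<lambda>v. {u'. delete_edge E u w u' v}"
    \<comment> \<open>The graphs cut by the individual nodes are replaced by one relation; agreement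
      of the keys is known for nodes below \<open>n\<close> only.\<close>
    have "Y (4 * h + 1) w = flood 1 ?N (\<lambda>v. if v = u then 0 else n) (4 * h + 1) w"
      unfolding Y_def
    proof (rule flood_cong[where A = "{..<n}"])
      fix v assume v: "v \<in> {..<n}"
      show "bfs_start n (key v) v = (if v = u then 0 else n)"
        using key v dec by (simp add: bfs_start_def)
      show "cut_nbs n (key v) (nbs v) v = ?N v"
        using key v dec nbs_iff by (auto simp: cut_nbs_def delete_edge_def)
      show "cut_nbs n (key v) (nbs v) v \<subseteq> {..<n}" by (auto simp: cut_nbs_def nbs_def)
    qed (use w in simp)
    moreover have "flood 1 ?N (\<lambda>v. if v = u then 0 else n) (4 * h + 1) w \<le> k"
      using flood_le[of "delete_edge E u w" ?N k u w "4 * h + 1" 1 "\<lambda>v. if v = u then 0 else n"] walk k(1)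
      by simp
    moreover obtain u2 j where "(delete_edge E u w ^^ j) u2 w"
        "flood 1 ?N (\<lambda>v. if v = u then 0 else n) (4 * h + 1) w = (if u2 = u then 0 else n) + 1 * j"
      using flood_attained[of ?N "delete_edge E u w" "4 * h + 1" w 1 "\<lambda>v. if v = u then 0 else n"] by blast
    \<comment> \<open>Start values other than the 0 at \<open>u\<close> equal \<open>n\<close>,
      which exceeds \<open>k\<close>.\<close>
    ultimately show ?thesis using least[of j] \<open>k < n\<close>
      by (cases "u2 = u"; cases "j < k") simp_all
  qed
  have Z: "Z (2 * h) v = Suc k" if v: "v < n" for v
  proof -
    let ?z = "\<lambda>v. out_start n (key v) (Y (4 * h + 1) v) v"
    have zw: "?z w = Suc k" using key[OF w] dec Y by (simp add: out_start_def)
    have zv: "Suc k \<le> ?z v" if "v < n" for v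
      using key[OF that] dec Y \<open>k < n\<close> by (simp add: out_start_def)
    have "Inf (?z ` {..<n}) = Suc k"
    proof (rule antisym)
      have "Inf (?z ` {..<n}) \<le> ?z w" using w by (intro wellorder_Inf_le1 imageI) simp
      then show "Inf (?z ` {..<n}) \<le> Suc k" unfolding zw .
      have "Inf (?z ` {..<n}) \<in> ?z ` {..<n}" using w by (intro wellorder_InfI[of "?z w"]) auto
      then show "Suc k \<le> Inf (?z ` {..<n})" using zv by auto
    qed
    then show ?thesis unfolding Z_def using flood_broadcast[OF v diam, of ?z] by simp
  qed
  obtain ys where ys: "is_cycle E ys" "length ys = Suc k"
    using cycle_through_edge[OF E_sym[OF edge] _ walk least] edge E_irrefl by blast
  have "girth E \<le> Suc k" unfolding girth_def using ys by (intro Least_le) blast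
  then show ?thesis using Z k(2) ys by blast
qed

end

section \<open>State machines as CONGEST algorithms\<close>

text \<open>A node sees the number of nodes, its identifier, its neighbours and its random bits; messages
  are triples of naturals, and \<^term>\<open>m_step\<close> also receives the message the node itself sent.\<close>

type_synonym ctx = "nat \<times> nat \<times> nat set \<times> bool list"
type_synonym msg = "nat \<times> nat \<times> nat"

record 's machine =
  m_init :: "ctx \<Rightarrow> 's"
  m_msg :: "ctx \<Rightarrow> 's \<Rightarrow> msg"
  m_step :: "ctx \<Rightarrow> 's \<Rightarrow> (nat \<Rightarrow> msg) \<Rightarrow> 's"
  m_halt :: "ctx \<Rightarrow> 's \<Rightarrow> bool"
  m_out :: "ctx \<Rightarrow> 's \<Rightarrow> nat"

text \<open>The largest number to be sent is \<open>no_key n\<close>, four times the cube of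
  \<open>n\<close>; two more factors \<open>n + 2\<close> absorb the 4.\<close>

definition cap :: "nat \<Rightarrow> nat" where
  "cap n = (n + 2) ^ 5"

text \<open>The bandwidth condition ranges over all states, reachable or not, hence the
  unconditional truncation; on the runs analysed below it changes nothing.\<close>

definition clamp_msg :: "nat \<Rightarrow> msg \<Rightarrow> msg" where
  "clamp_msg n = (\<lambda>(a, b, c). (min a (cap n - 1), min b (cap n - 1), min c (cap n - 1)))"

definition only_from :: "nat set \<Rightarrow> (nat \<Rightarrow> msg) \<Rightarrow> nat \<Rightarrow> msg" where
  "only_from A M u = (if u \<in> A then M u else (0, 0, 0))"

definition node_ctx :: "nat \<Rightarrow> (nat \<Rightarrow> nat \<Rightarrow> bool) \<Rightarrow> (nat \<Rightarrow> bool list) \<Rightarrow> nat \<Rightarrow> ctx" where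
  "node_ctx n E r v = (n, v, {u. u < n \<and> E v u}, r v)"

fun mrun :: "'s machine \<Rightarrow> nat \<Rightarrow> (nat \<Rightarrow> nat \<Rightarrow> bool) \<Rightarrow> (nat \<Rightarrow> bool list) \<Rightarrow> nat \<Rightarrow> nat \<Rightarrow> 's" where
  "mrun P n E r 0 v = m_init P (node_ctx n E r v)"
| "mrun P n E r (Suc t) v = m_step P (node_ctx n E r v) (mrun P n E r t v)
     (only_from (insert v {u. u < n \<and> E v u})
       (\<lambda>u. clamp_msg n (m_msg P (node_ctx n E r u) (mrun P n E r t u))))"

definition msg_space :: "nat \<Rightarrow> msg set" where
  "msg_space n = {..<cap n} \<times> {..<cap n} \<times> {..<cap n}"

text \<open>Three components below \<open>(n + 2) ^ 5\<close> each, so 15 times the rounded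
  logarithm.\<close>

definition msg_length :: "nat \<Rightarrow> nat" where
  "msg_length n = nat \<lceil>log 2 (real n + 2)\<rceil> * 15"

text \<open>Local computation is free, so any injection will do; it depends on \<open>n\<close> only
  and is thus common to all nodes.\<close>

definition encode :: "nat \<Rightarrow> msg \<Rightarrow> bool list" where
  "encode n = (SOME f. f ` msg_space n \<subseteq> {xs. length xs = msg_length n} \<and> inj_on f (msg_space n))"

lemma clamp_in_msg_space: "clamp_msg n m \<in> msg_space n"
proof -
  have "0 < cap n" by (simp add: cap_def)
  then show ?thesis by (cases m) (auto simp: clamp_msg_def msg_space_def min_def)
qed

lemma encode_spec:
  "encode n ` msg_space n \<subseteq> {xs. length xs = msg_length n} \<and> inj_on (encode n) (msg_space n)"
proof -
  define l where "l = nat \<lceil>log 2 (real n + 2)\<rceil>"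
  have "real n + 2 = 2 powr log 2 (real n + 2)" by (rule powr_log_cancel[symmetric]) auto
  also have "\<dots> \<le> 2 powr real l"
    unfolding l_def by (intro powr_mono real_nat_ceiling_ge) simp
  also have "\<dots> = 2 ^ l" by (simp add: powr_realpow)
  finally have "real n + 2 \<le> 2 ^ l" .
  then have "real (n + 2) \<le> real (2 ^ l)" by simp
  then have "n + 2 \<le> 2 ^ l" by (simp only: of_nat_le_iff)
  then have "(n + 2) ^ 15 \<le> (2 ^ l) ^ 15" by (rule power_mono) (rule le0)
  also have "\<dots> = 2 ^ msg_length n"
    unfolding msg_length_def l_def by (rule power_mult[symmetric])
  finally have le: "(n + 2) ^ 15 \<le> 2 ^ msg_length n" .
  have "card (msg_space n) = (n + 2) ^ 15"
    unfolding msg_space_def card_cartesian_product card_lessThan cap_def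
    by (simp flip: power_add)
  also note le
  also have "2 ^ msg_length n = card {xs :: bool list. length xs = msg_length n}"
    using card_lists_length_eq[of "UNIV :: bool set" "msg_length n"] by simp
  finally have "card (msg_space n) \<le> card {xs :: bool list. length xs = msg_length n}" .
  moreover have "finite {xs :: bool list. length xs = msg_length n}"
    using finite_lists_length_eq[of "UNIV :: bool set" "msg_length n"] by simp
  ultimately have "\<exists>f. f ` msg_space n \<subseteq> {xs :: bool list. length xs = msg_length n}
      \<and> inj_on f (msg_space n)"
    by (intro card_le_inj) (auto simp: msg_space_def)
  then show ?thesis unfolding encode_def by (rule someI_ex)
qed

definition decode :: "nat \<Rightarrow> bool list \<Rightarrow> msg" where
  "decode n = inv_into (msg_space n) (encode n)"

lemma decode_encode: "decode n (encode n (clamp_msg n m)) = clamp_msg n m"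
  unfolding decode_def using encode_spec clamp_in_msg_space by (simp add: inv_into_f_f)

lemma length_encode: "length (encode n (clamp_msg n m)) = msg_length n"
  using encode_spec clamp_in_msg_space by blast

text \<open>A node stores its context and the lists of messages received so far, which are countable data,
  and recomputes the state of the machine from them.\<close>

type_synonym history = "nat \<times> nat \<times> nat list \<times> bool list \<times> bool list list list"

text \<open>No node receives a message from itself, so its own one is recomputed from its state; the
  others are matched with their senders by the order of the neighbour list.\<close>

fun replay :: "'s machine \<Rightarrow> history \<Rightarrow> 's" where
  "replay P (n, v, Nl, r, hist) = foldl (\<lambda>s ms. m_step P (n, v, set Nl, r) s
     (\<lambda>u. if u = v then clamp_msg n (m_msg P (n, v, set Nl, r) s)
          else case map_of (zip Nl ms) u of None \<Rightarrow> (0, 0, 0) | Some bs \<Rightarrow> decode n bs))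
     (m_init P (n, v, set Nl, r)) hist"

fun hist_ctx :: "history \<Rightarrow> ctx" where
  "hist_ctx (n, v, Nl, r, hist) = (n, v, set Nl, r)"

fun hist_append :: "history \<Rightarrow> (nat \<Rightarrow> bool list) \<Rightarrow> history" where
  "hist_append (n, v, Nl, r, hist) M = (n, v, Nl, r, hist @ [map M Nl])"

definition congest_of :: "(nat \<Rightarrow> nat) \<Rightarrow> 's machine \<Rightarrow> congest_alg" where
  "congest_of bits P = \<lparr>
     c_init = (\<lambda>n v N r. to_nat ((n, v, sorted_list_of_set N, r, []) :: history)),
     c_bits = bits,
     c_send = (\<lambda>n s u. let h = from_nat s in encode n (clamp_msg n (m_msg P (hist_ctx h) (replay P h)))),
     c_recv = (\<lambda>s M. to_nat (hist_append (from_nat s) M)),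
     c_halted = (\<lambda>s. let h = from_nat s in m_halt P (hist_ctx h) (replay P h)),
     c_out = (\<lambda>s. let h = from_nat s in m_out P (hist_ctx h) (replay P h))\<rparr>"

lemma congest_of_simps:
  "c_init (congest_of bits P) n v N r = to_nat ((n, v, sorted_list_of_set N, r, []) :: history)"
  "c_send (congest_of bits P) n (to_nat h) u =
     encode n (clamp_msg n (m_msg P (hist_ctx h) (replay P h)))"
  "c_recv (congest_of bits P) (to_nat h) M = to_nat (hist_append h M)"
  "c_halted (congest_of bits P) (to_nat h) = m_halt P (hist_ctx h) (replay P h)"
  "c_out (congest_of bits P) (to_nat h) = m_out P (hist_ctx h) (replay P h)"
  by (simp_all add: congest_of_def Let_def)

lemma congest_of_bandwidth: "congest_bandwidth (congest_of bits P) 30"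
proof -
  have "real (msg_length n) \<le> 30 * log 2 (real n + 2)" for n
  proof -
    \<comment> \<open>As the logarithm is at least 1, rounding up at most doubles it: 2 * 15 =
      30.\<close>
    have "1 \<le> log 2 (real n + 2)" by (simp add: le_log_iff)
    moreover have "real (nat \<lceil>log 2 (real n + 2)\<rceil>) \<le> log 2 (real n + 2) + 1"
      using calculation by linarith
    ultimately show ?thesis unfolding msg_length_def of_nat_mult of_nat_numeral by linarith
  qed
  then show ?thesis
    unfolding congest_bandwidth_def congest_of_def by (simp add: Let_def length_encode)
qed

lemma exec_congest_of:
  assumes "graph_on n E"
  shows "\<exists>h. exec (congest_of bits P) n E r t v = to_nat (h :: history) \<and>
     hist_ctx h = node_ctx n E r v \<and> replay P h = mrun P n E r t v"
proof (induction t arbitrary: v)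
  case 0
  have "finite {u. u < n \<and> E v u}" by simp
  then show ?case
    by (intro exI[of _ "(n, v, sorted_list_of_set {u. u < n \<and> E v u}, r v, [])"])
       (simp add: congest_of_simps node_ctx_def)
next
  case (Suc t)
  have sym: "E u v \<longleftrightarrow> E v u" for u using assms unfolding graph_on_def by blast
  obtain H where H: "\<And>u. exec (congest_of bits P) n E r t u = to_nat (H u :: history)"
      "\<And>u. hist_ctx (H u) = node_ctx n E r u" "\<And>u. replay P (H u) = mrun P n E r t u"
    using Suc.IH by metis
  obtain Nl hist where Hv: "H v = (n, v, Nl, r v, hist)" and Nl: "set Nl = {u. u < n \<and> E v u}"
    using H(2)[of v] by (cases "H v") (auto simp: node_ctx_def)
  define m where "m u = clamp_msg n (m_msg P (node_ctx n E r u) (mrun P n E r t u))" for u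
  define M where "M u = (if u < n \<and> E u v then encode n (m u) else [])" for u
  have ex: "exec (congest_of bits P) n E r (Suc t) v = to_nat (hist_append (H v) M)"
    unfolding exec.simps H(1) congest_of_simps H(2,3) M_def m_def ..
  have irrefl: "\<not> E v v" using assms unfolding graph_on_def by blast
  have "(if u = v then clamp_msg n (m_msg P (n, v, set Nl, r v) (replay P (H v)))
          else case map_of (zip Nl (map M Nl)) u of None \<Rightarrow> (0, 0, 0) | Some bs \<Rightarrow> decode n bs)
      = only_from (insert v {u. u < n \<and> E v u}) m u" for u
  proof (cases "u = v")
    case True
    then show ?thesis using H(3)[of v] by (simp add: only_from_def m_def Nl node_ctx_def)
  next
    case False
    show ?thesis
    proof (cases "u \<in> set Nl")
      case True
      then have "u < n" "E v u" "E u v" using Nl sym[of u] by auto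
      then show ?thesis using True False
        by (simp add: map_of_zip_map only_from_def M_def m_def decode_encode)
    next
      case notin: False
      then have "\<not> (u < n \<and> E v u)" using Nl by blast
      then show ?thesis using notin False by (auto simp: map_of_zip_map only_from_def)
    qed
  qed
  then have received: "(\<lambda>u. if u = v then clamp_msg n (m_msg P (n, v, set Nl, r v) (replay P (H v)))
          else case map_of (zip Nl (map M Nl)) u of None \<Rightarrow> (0, 0, 0) | Some bs \<Rightarrow> decode n bs)
      = only_from (insert v {u. u < n \<and> E v u}) m" by (rule ext)
  have "replay P (hist_append (H v) M) = m_step P (n, v, set Nl, r v) (replay P (H v))
     (\<lambda>u. if u = v then clamp_msg n (m_msg P (n, v, set Nl, r v) (replay P (H v)))
          else case map_of (zip Nl (map M Nl)) u of None \<Rightarrow> (0, 0, 0) | Some bs \<Rightarrow> decode n bs)"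
    unfolding Hv by (simp cong: if_cong)
  then have "replay P (hist_append (H v) M) = mrun P n E r (Suc t) v"
    unfolding received unfolding H(3) by (simp add: m_def[abs_def] Nl node_ctx_def)
  moreover have "hist_ctx (hist_append (H v) M) = node_ctx n E r v"
    using H(2)[of v] unfolding Hv by simp
  ultimately show ?case using ex by (intro exI[of _ "hist_append (H v) M"] conjI)
qed

lemma c_halted_congest_of:
  assumes "graph_on n E"
  shows "c_halted (congest_of bits P) (exec (congest_of bits P) n E r t v)
    \<longleftrightarrow> m_halt P (node_ctx n E r v) (mrun P n E r t v)"
  using exec_congest_of[OF assms, of bits P r t v]
  by (auto simp: congest_of_simps)

lemma c_out_congest_of:
  assumes "graph_on n E"
  shows "c_out (congest_of bits P) (exec (congest_of bits P) n E r t v)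
    = m_out P (node_ctx n E r v) (mrun P n E r t v)"
  using exec_congest_of[OF assms, of bits P r t v]
  by (auto simp: congest_of_simps)

section \<open>Random sources\<close>

lemma two_power_le_exp: "2 ^ k \<le> exp (real k)"
proof -
  have "(2 :: real) \<le> exp 1" using exp_ge_add_one_self[of 1] by simp
  then have "(2 :: real) ^ k \<le> exp 1 ^ k" by (rule power_mono) simp
  then show ?thesis by (simp add: exp_of_nat_mult[symmetric])
qed

context
  fixes n b :: nat and q :: real and p :: "(nat \<Rightarrow> bool list) pmf"
  assumes n_pos: "0 < n" and n_le: "n \<le> 4 ^ b"
  defines "q \<equiv> 2 ^ b"
    and "p \<equiv> Pi_pmf {..<n} [] (\<lambda>_. pmf_of_set {xs. length xs = b})"
begin

text \<open>A power of two as \<open>q\<close> lets \<open>b\<close> fair bits realise the sampling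
  probability exactly.\<close>

lemma prob_all_heads:
  "measure_pmf.prob (pmf_of_set {xs. length xs = b}) {replicate b True} = 1 / q"
proof -
  have fin: "finite {xs :: bool list. length xs = b}" and card: "card {xs :: bool list. length xs = b} = 2 ^ b"
    using finite_lists_length_eq[of "UNIV :: bool set" b] card_lists_length_eq[of "UNIV :: bool set" b]
    by simp_all
  have ne: "{xs :: bool list. length xs = b} \<noteq> {}" by (simp add: Collect_empty_eq) (metis length_replicate)
  have "{xs :: bool list. length xs = b} \<inter> {replicate b True} = {replicate b True}" by auto
  then show ?thesis using measure_pmf_of_set[OF ne fin, of "{replicate b True}"] card
    unfolding q_def by simp
qed

text \<open>Each of the two bad events receives half of the failure probability
  \<open>1 / n\<close>.\<close>

lemma tail_le: "1 / 2 ^ (2 * b + 1) \<le> 1 / (2 * real n)"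
proof -
  have "real n \<le> real (4 ^ b)" using n_le by (simp only: of_nat_le_iff)
  then have "2 * real n \<le> 2 ^ (2 * b + 1)" by (simp add: power_mult)
  then show ?thesis using n_pos by (intro divide_left_mono) auto
qed

text \<open>The nodes of \<open>B\<close> miss independently, with probability
  \<open>(1 - 1 / q) ^ card B\<close> in total; \<open>q * (2 * b + 1)\<close> nodes push this down
  to \<open>exp (- (2 * b + 1))\<close>.\<close>

lemma prob_unhit:
  assumes B: "B \<subseteq> {..<n}" "2 ^ b * (2 * b + 1) \<le> card B"
  shows "measure_pmf.prob p {r. \<forall>v\<in>B. r v \<noteq> replicate b True} \<le> 1 / (2 * real n)"
proof -
  define X where "X v = (if v \<in> B then - {replicate b True} else (UNIV :: bool list set))" for v
  have q1: "1 \<le> q" unfolding q_def by simp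
  have "{r. \<forall>v\<in>B. r v \<noteq> replicate b True} = Pi {..<n} X"
    using B(1) by (auto simp: X_def Pi_iff split: if_splits)
  then have "measure_pmf.prob p {r. \<forall>v\<in>B. r v \<noteq> replicate b True} =
      (\<Prod>v<n. measure_pmf.prob (pmf_of_set {xs. length xs = b}) (X v))"
    unfolding p_def by (simp add: measure_Pi_pmf_Pi)
  also have "\<dots> = (\<Prod>v<n. if v \<in> B then 1 - 1 / q else 1)"
  proof (rule prod.cong)
    fix v
    show "measure_pmf.prob (pmf_of_set {xs. length xs = b}) (X v) = (if v \<in> B then 1 - 1 / q else 1)"
      using measure_pmf.prob_compl[of "{replicate b True}" "pmf_of_set {xs. length xs = b}"]
      by (simp add: X_def prob_all_heads Compl_eq_Diff_UNIV)
  qed simp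
  also have "\<dots> = (1 - 1 / q) ^ card B"
    using B(1) prod.inter_restrict[of "{..<n}" "\<lambda>_. 1 - 1 / q" B] by (simp add: Int_absorb1)
  also have "\<dots> \<le> (1 - 1 / q) ^ (2 ^ b * (2 * b + 1))"
    using q1 B(2) by (intro power_decreasing) auto
  also have "\<dots> \<le> exp (- 1 / q) ^ (2 ^ b * (2 * b + 1))"
    using exp_ge_add_one_self[of "- 1 / q"] q1 by (intro power_mono) auto
  also have "\<dots> = exp (- real (2 * b + 1))"
    unfolding exp_of_nat_mult[symmetric] q_def by (simp add: field_simps)
  also have "\<dots> = 1 / exp (real (2 * b + 1))" by (simp only: exp_minus inverse_eq_divide)
  also have "\<dots> \<le> 1 / 2 ^ (2 * b + 1)"
    using two_power_le_exp[of "2 * b + 1"] by (intro divide_left_mono) simp_all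
  also note tail_le
  finally show ?thesis .
qed

text \<open>Chernoff's method with base 2: Markov's inequality for 2 to the number of sources, whose
  expectation \<open>(1 + 1 / q) ^ n\<close> is at most \<open>2 ^ (2 * 2 ^ b)\<close>.\<close>

lemma prob_many:
  "measure_pmf.prob p {r. 2 * 2 ^ b + 2 * b + 1 \<le> card {v. v < n \<and> r v = replicate b True}}
    \<le> 1 / (2 * real n)"
proof -
  define f :: "bool list \<Rightarrow> real" where "f xs = (if xs = replicate b True then 2 else 1)" for xs
  define m where "m = 2 * 2 ^ b + 2 * b + 1"
  have prod: "(\<Prod>v<n. f (r v)) = 2 ^ card {v. v < n \<and> r v = replicate b True}" for r
    unfolding f_def by (simp add: prod.If_cases Int_def)
  have fin: "finite (set_pmf (pmf_of_set {xs :: bool list. length xs = b}))"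
    using finite_lists_length_eq[of "UNIV :: bool set" b] length_replicate
    by (subst set_pmf_of_set) (simp_all add: Collect_empty_eq, metis length_replicate)
  have "f = (\<lambda>xs. 1 + indicator {replicate b True} xs)" by (auto simp: f_def fun_eq_iff)
  then have Ef: "measure_pmf.expectation (pmf_of_set {xs. length xs = b}) f = 1 + 1 / q"
    using prob_all_heads fin by (simp add: integrable_measure_pmf_finite)
  have int: "integrable (measure_pmf p) (\<lambda>r. \<Prod>v<n. f (r v))"
    unfolding p_def using fin by (intro integrable_measure_pmf_finite) (simp add: set_Pi_pmf finite_PiE_dflt)
  have "measure_pmf.prob p {r. m \<le> card {v. v < n \<and> r v = replicate b True}}
    = measure_pmf.prob p {r \<in> space (measure_pmf p). 2 ^ m \<le> (\<Prod>v<n. f (r v))}"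
    by (simp add: prod)
  also have "\<dots> \<le> measure_pmf.expectation p (\<lambda>r. \<Prod>v<n. f (r v)) / 2 ^ m"
    by (rule integral_Markov_inequality_measure[where A = "{}"]) (use int in \<open>auto simp: prod\<close>)
  also have "measure_pmf.expectation p (\<lambda>r. \<Prod>v<n. f (r v)) = (1 + 1 / q) ^ n"
    unfolding p_def using fin Ef
    by (subst expectation_prod_Pi_pmf) (auto simp: f_def intro: integrable_measure_pmf_finite)
  also have "(1 + 1 / q) ^ n / 2 ^ m \<le> 2 ^ (2 * 2 ^ b) / 2 ^ m"
  proof (rule divide_right_mono)
    have q: "q > 0" "q * q = real (4 ^ b)"
      unfolding q_def by (simp_all flip: power_mult_distrib)
    have "real n \<le> real (4 ^ b)" using n_le by (simp only: of_nat_le_iff)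
    \<comment> \<open>The expected number of sources is at most \<open>q\<close>, since
      \<open>n \<le> q * q\<close>.\<close>
    then have nq: "real n / q \<le> q" using q by (simp add: divide_le_eq)
    have "(1 + 1 / q) ^ n \<le> exp (1 / q) ^ n"
      using exp_ge_add_one_self[of "1 / q"] q by (intro power_mono) (auto simp: add.commute)
    also have "\<dots> = exp (real n / q)" by (simp flip: exp_of_nat_mult)
    also have "\<dots> \<le> exp (real (2 ^ b))" using nq by (simp add: q_def)
    also have "\<dots> = exp 1 ^ 2 ^ b" using exp_of_nat_mult[of "2 ^ b" "1::real"] by simp
    also have "\<dots> \<le> 4 ^ 2 ^ b" using exp_le by (intro power_mono) auto
    also have "\<dots> = 2 ^ (2 * 2 ^ b)" by (simp add: power_mult)
    finally show "(1 + 1 / q) ^ n \<le> 2 ^ (2 * 2 ^ b)" .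
  qed simp
  also have "\<dots> = 1 / 2 ^ (2 * b + 1)" unfolding m_def by (simp add: power_add)
  also note tail_le
  finally show ?thesis unfolding m_def .
qed

lemma prob_good:
  assumes "B \<subseteq> {..<n}"
  shows "1 - 1 / real n \<le> measure_pmf.prob p
    {r. (2 ^ b * (2 * b + 1) \<le> card B \<longrightarrow> (\<exists>v\<in>B. r v = replicate b True)) \<and>
        card {v. v < n \<and> r v = replicate b True} \<le> 2 * 2 ^ b + 2 * b}"
    (is "_ \<le> measure_pmf.prob p ?good")
proof -
  let ?bad1 = "{r. 2 ^ b * (2 * b + 1) \<le> card B \<and> (\<forall>v\<in>B. r v \<noteq> replicate b True)}"
  let ?bad2 = "{r. 2 * 2 ^ b + 2 * b + 1 \<le> card {v. v < n \<and> r v = replicate b True}}"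
  have bad1: "measure_pmf.prob p ?bad1 \<le> 1 / (2 * real n)"
    by (cases "2 ^ b * (2 * b + 1) \<le> card B") (use prob_unhit[OF assms] in simp_all)
  have "measure_pmf.prob p (- ?good) \<le> measure_pmf.prob p (?bad1 \<union> ?bad2)"
    by (intro measure_pmf.finite_measure_mono) auto
  also have "\<dots> \<le> measure_pmf.prob p ?bad1 + measure_pmf.prob p ?bad2"
    by (rule measure_Un_le) auto
  also have "\<dots> \<le> 1 / (2 * real n) + 1 / (2 * real n)"
    by (intro add_mono bad1 prob_many)
  also have "\<dots> = 1 / real n" using n_pos by simp
  finally show ?thesis
    using measure_pmf.prob_compl[of ?good p] by (simp add: Compl_eq_Diff_UNIV)
qed

end

section \<open>The algorithm\<close>

text \<open>This makes \<open>2 ^ b\<close> at least \<surd>n and, for positive \<open>n\<close>,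
  less than twice that.\<close>

definition sample_bits :: "nat \<Rightarrow> nat" where
  "sample_bits n = (LEAST b. n \<le> 4 ^ b)"

text \<open>Sum of the ball size that is hit with high probability, the bound on the number of
  random sources, and 1 for node 0; so one number serves as \<open>K\<close> for both kinds of
  waiting.\<close>

definition budget :: "nat \<Rightarrow> nat" where
  "budget n = (let b = sample_bits n in 2 ^ b * (2 * b + 1) + 2 * 2 ^ b + 2 * b + 1)"

text \<open>Phase \<open>p\<close> guesses that every node is within distance \<open>2 ^ p\<close> of node \<open>0\<close>. Its three kinds of
  rounds end at the following times; the remaining \<open>2 * 2 ^ p\<close> rounds spread the output. The election
  has one round more than a correct guess needs: if the guess is wrong, some node within distance
  \<open>2 * 2 ^ p + 1\<close> of any given node has missed node \<open>0\<close> and floods the failure key.\<close>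

definition end_detect :: "nat \<Rightarrow> nat \<Rightarrow> nat" where
  "end_detect n p = budget n + 2 * 2 ^ p"

definition end_elect :: "nat \<Rightarrow> nat \<Rightarrow> nat" where
  "end_elect n p = end_detect n p + (2 * 2 ^ p + 1)"

definition end_bfs :: "nat \<Rightarrow> nat \<Rightarrow> nat" where
  "end_bfs n p = end_elect n p + (4 * 2 ^ p + 1)"

definition phase_length :: "nat \<Rightarrow> nat \<Rightarrow> nat" where
  "phase_length n p = end_bfs n p + 2 * 2 ^ p"

record node =
  phase_no :: nat
  clock :: nat
  keys_all :: "nat \<Rightarrow> nat set"
  keys_sample :: "nat \<Rightarrow> nat set"
  best :: nat
  bfs :: nat
  result :: nat

definition fresh :: "nat \<Rightarrow> node" where
  "fresh p = \<lparr>phase_no = p, clock = 0, keys_all = \<lambda>_. {}, keys_sample = \<lambda>_. {},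
     best = 0, bfs = 0, result = 0\<rparr>"

fun in_sample :: "ctx \<Rightarrow> bool" where
  "in_sample (n, v, N, r) \<longleftrightarrow> v = 0 \<or> r = replicate (sample_bits n) True"

fun node_msg :: "ctx \<Rightarrow> node \<Rightarrow> msg" where
  "node_msg (n, v, N, r) s =
     (next_key n N v True (keys_all s), next_key n N v (in_sample (n, v, N, r)) (keys_sample s),
      if clock s < end_elect n (phase_no s) then best s
      else if clock s < end_bfs n (phase_no s) then bfs s else result s)"

text \<open>Until its stage begins, a field is recomputed in every round from the values just
  obtained, so the last round of one stage already initialises the next. Halting is tested in the
  state with the final clock; the step from that state starts the next guess.\<close>

fun node_step :: "ctx \<Rightarrow> node \<Rightarrow> (nat \<Rightarrow> msg) \<Rightarrow> node" where
  "node_step (n, v, N, r) s M =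
     (let p = phase_no s; t = clock s; m = (\<lambda>u. snd (snd (M u)));
        ka = (if t < end_detect n p then \<lambda>u. insert (fst (M u)) (keys_all s u) else keys_all s);
        ks = (if t < end_detect n p then \<lambda>u. insert (fst (snd (M u))) (keys_sample s u)
              else keys_sample s);
        x = (if t < end_detect n p then local_key n N v (in_sample (n, v, N, r)) (2 ^ p) ka ks
             else if t < end_elect n p then flood_step 0 N v m else best s);
        y = (if t < end_elect n p then bfs_start n x v
             else if t < end_bfs n p then flood_step 1 (cut_nbs n x N v) v m else bfs s);
        z = (if t < end_bfs n p then out_start n x y v else flood_step 0 N v m)
      in if t = phase_length n p then fresh (Suc p)
         else \<lparr>phase_no = p, clock = Suc t, keys_all = ka, keys_sample = ks,
           best = x, bfs = y, result = z\<rparr>)"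

fun node_halted :: "ctx \<Rightarrow> node \<Rightarrow> bool" where
  "node_halted (n, v, N, r) s \<longleftrightarrow> clock s = phase_length n (phase_no s) \<and> best s \<noteq> 0"

definition girth_machine :: "node machine" where
  "girth_machine = \<lparr>m_init = (\<lambda>_. fresh 0), m_msg = node_msg, m_step = node_step,
     m_halt = node_halted, m_out = (\<lambda>_ s. result s)\<rparr>"

definition girth_alg :: congest_alg where
  "girth_alg = congest_of sample_bits girth_machine"

lemma cap_bounds: "n * n \<le> cap n - 1" "no_key n \<le> cap n - 1" "Suc n \<le> cap n - 1"
proof -
  define m where "m = n + 2"
  have "cap n = m ^ 5" unfolding cap_def m_def ..
  also have "m ^ 5 = m * m * m * (m * m)" by (simp add: eval_nat_numeral)
  finally have cap: "cap n = m * m * m * (m * m)" .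
  have m: "n < m" "2 \<le> m" by (simp_all add: m_def)
  have cube: "n * n * n < m * m * m" using m by (intro mult_strict_mono) auto
  have four: "4 \<le> m * m" using mult_le_mono[OF m(2) m(2)] by simp
  have "n * n * n * 4 < m * m * m * (m * m)" by (rule mult_less_le_imp_less[OF cube four]) simp_all
  then show "no_key n \<le> cap n - 1" by (simp add: no_key_def cap)
  have "m * 1 \<le> m * (m * m * (m * m))" using m(2) by (intro mult_le_mono) auto
  then have "m \<le> cap n" by (simp add: cap mult.assoc)
  then show "Suc n \<le> cap n - 1" by (simp add: m_def)
  have "n * n < m * m" using m by (intro mult_strict_mono) auto
  also have "m * m * 1 \<le> m * m * (m * m * m)" using m(2) by (intro mult_le_mono) auto
  then have "m * m \<le> cap n" by (simp only: cap mult.assoc mult_1_right)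
  finally show "n * n \<le> cap n - 1" by simp
qed

lemma clamp_msg_eq:
  "fst (clamp_msg n m) = min (fst m) (cap n - 1)"
  "fst (snd (clamp_msg n m)) = min (fst (snd m)) (cap n - 1)"
  "snd (snd (clamp_msg n m)) = min (snd (snd m)) (cap n - 1)"
  by (cases m; simp add: clamp_msg_def)+

lemma node_step_fields:
  fixes n v :: nat and N :: "nat set" and r :: "bool list" and s :: node and M :: "nat \<Rightarrow> msg"
  assumes "clock s \<noteq> phase_length n (phase_no s)"
  defines "s' \<equiv> node_step (n, v, N, r) s M" and "p \<equiv> phase_no s" and "t \<equiv> clock s"
    and "m \<equiv> \<lambda>u. snd (snd (M u))"
  shows "phase_no s' = p" "clock s' = Suc t"
    "keys_all s' = (if t < end_detect n p then \<lambda>u. insert (fst (M u)) (keys_all s u) else keys_all s)"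
    "keys_sample s' =
       (if t < end_detect n p then \<lambda>u. insert (fst (snd (M u))) (keys_sample s u) else keys_sample s)"
    "best s' = (if t < end_detect n p
         then local_key n N v (in_sample (n, v, N, r)) (2 ^ p) (keys_all s') (keys_sample s')
       else if t < end_elect n p then flood_step 0 N v m else best s)"
    "bfs s' = (if t < end_elect n p then bfs_start n (best s') v
       else if t < end_bfs n p then flood_step 1 (cut_nbs n (best s') N v) v m else bfs s)"
    "result s' = (if t < end_bfs n p then out_start n (best s') (bfs s') v else flood_step 0 N v m)"
  using assms(1) unfolding s'_def p_def t_def m_def by (simp_all add: Let_def del: in_sample.simps)

declare node_step.simps [simp del] node_msg.simps [simp del] in_sample.simps [simp del]

section \<open>The state machine follows the specification of a phase\<close>

context phase
begin

lemma X_le: "X t v \<le> no_key n"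
proof -
  have "X t v \<le> X0 v" unfolding X_def by (rule flood_decreasing)
  also have "\<dots> \<le> no_key n" unfolding X0_def by (rule local_key_le)
  finally show ?thesis .
qed

lemma Y_le: "Y t v \<le> n"
proof -
  have "Y t v \<le> bfs_start n (key v) v" unfolding Y_def by (rule flood_decreasing)
  also have "\<dots> \<le> n" by (simp add: bfs_start_def)
  finally show ?thesis .
qed

lemma Z_le: "Z t v \<le> Suc n"
proof -
  have "Z t v \<le> out_start n (key v) (Y (4 * h + 1) v) v" unfolding Z_def by (rule flood_decreasing)
  also have "\<dots> \<le> Suc n" using Y_le by (simp add: out_start_def)
  finally show ?thesis .
qed

definition elected where "elected = rounds + (2 * h + 1)"
definition searched where "searched = elected + (4 * h + 1)"

text \<open>The minima say that values are frozen once their stage is over; before a stage its field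
  is provisional and nothing is claimed. Key sets are tracked for the node and its neighbours, the
  only ones it hears.\<close>

definition phase_state :: "nat \<Rightarrow> nat \<Rightarrow> nat \<Rightarrow> node \<Rightarrow> bool" where
  "phase_state p t v s \<longleftrightarrow> phase_no s = p \<and> clock s = t \<and>
     (\<forall>u\<in>insert v (nbs v). keys_all s u = sent {..<n} (min t rounds) u \<and>
        keys_sample s u = sent S (min t rounds) u) \<and>
     (rounds \<le> t \<longrightarrow> best s = X (min (t - rounds) (2 * h + 1)) v) \<and>
     (elected \<le> t \<longrightarrow> bfs s = Y (min (t - elected) (4 * h + 1)) v) \<and>
     (searched \<le> t \<longrightarrow> result s = Z (t - searched) v)"

context
  fixes p :: nat and r :: "nat \<Rightarrow> bool list" and c :: "nat \<Rightarrow> ctx"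
  assumes h: "h = 2 ^ p" and K: "K = budget n"
    and c: "\<And>v. c v = (n, v, nbs v, r v)" and sample: "\<And>v. v < n \<Longrightarrow> in_sample (c v) \<longleftrightarrow> v \<in> S"
begin

lemma ends: "end_detect n p = rounds" "end_elect n p = elected" "end_bfs n p = searched"
  "phase_length n p = searched + 2 * h"
  by (simp_all add: end_detect_def rounds_def end_elect_def elected_def end_bfs_def searched_def
      phase_length_def flip: h K)

text \<open>At clock 0 the invariant may claim nothing about \<open>best\<close>, which
  \<open>fresh\<close> sets to 0.\<close>

lemma rounds_pos: "0 < rounds"
  unfolding rounds_def using K by (simp add: budget_def Let_def)

text \<open>Truncation is harmless here because all values sent stay below
  \<open>cap n\<close>.\<close>

lemma phase_state_msg:
  assumes s: "phase_state p t u s" and u: "u < n"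
  defines "M \<equiv> clamp_msg n (node_msg (c u) s)"
  shows "t < rounds \<Longrightarrow> fst M = next_key n (nbs u) u (u \<in> {..<n}) (sent {..<n} t)"
    and "t < rounds \<Longrightarrow> fst (snd M) = next_key n (nbs u) u (u \<in> S) (sent S t)"
    and "rounds \<le> t \<Longrightarrow> t < elected \<Longrightarrow> snd (snd M) = X (t - rounds) u"
    and "elected \<le> t \<Longrightarrow> t < searched \<Longrightarrow> snd (snd M) = Y (t - elected) u"
    and "searched \<le> t \<Longrightarrow> snd (snd M) = Z (t - searched) u"
proof -
  have msg: "node_msg (c u) s = (next_key n (nbs u) u True (keys_all s),
      next_key n (nbs u) u (u \<in> S) (keys_sample s),
      if t < elected then best s else if t < searched then bfs s else result s)"
    using sample[OF u] s unfolding c phase_state_def by (simp add: node_msg.simps ends)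
  note next_le = min_absorb1[OF le_trans[OF next_key_le cap_bounds(1)]]
  have min: "min t rounds = t" if "t < rounds" using that by simp
  have keys: "next_key n (nbs u) u b (keys_all s) = next_key n (nbs u) u b (sent {..<n} t)"
    "next_key n (nbs u) u b (keys_sample s) = next_key n (nbs u) u b (sent S t)" if "t < rounds" for b
    using s unfolding phase_state_def min[OF that] by (blast intro: next_key_cong)+
  show "fst M = next_key n (nbs u) u (u \<in> {..<n}) (sent {..<n} t)" if "t < rounds"
  proof -
    have "fst M = next_key n (nbs u) u True (keys_all s)"
      unfolding M_def clamp_msg_eq msg fst_conv snd_conv by (rule next_le)
    also have "\<dots> = next_key n (nbs u) u True (sent {..<n} t)" by (rule keys(1)[OF that])
    finally show ?thesis using u by simp
  qed
  show "fst (snd M) = next_key n (nbs u) u (u \<in> S) (sent S t)" if "t < rounds"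
  proof -
    have "fst (snd M) = next_key n (nbs u) u (u \<in> S) (keys_sample s)"
      unfolding M_def clamp_msg_eq msg fst_conv snd_conv by (rule next_le)
    also have "\<dots> = next_key n (nbs u) u (u \<in> S) (sent S t)" by (rule keys(2)[OF that])
    finally show ?thesis using u by simp
  qed
  show "snd (snd M) = X (t - rounds) u" if "rounds \<le> t" "t < elected"
  proof -
    have "best s = X (t - rounds) u" using s that by (simp add: phase_state_def elected_def)
    then show ?thesis using that le_trans[OF X_le cap_bounds(2)]
      unfolding M_def clamp_msg_eq msg by (simp add: min_absorb1)
  qed
  show "snd (snd M) = Y (t - elected) u" if "elected \<le> t" "t < searched"
  proof -
    have "bfs s = Y (t - elected) u" using s that by (simp add: phase_state_def searched_def)
    moreover have "Y (t - elected) u \<le> cap n - 1" using Y_le[of "t - elected" u] cap_bounds(3)[of n] by simp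
    ultimately show ?thesis using that unfolding M_def clamp_msg_eq msg by (simp add: min_absorb1)
  qed
  show "snd (snd M) = Z (t - searched) u" if "searched \<le> t"
  proof -
    have "elected \<le> t" using that by (simp add: searched_def)
    moreover have "result s = Z (t - searched) u" using s that by (simp add: phase_state_def)
    moreover have "Z (t - searched) u \<le> cap n - 1" using Z_le[of "t - searched" u] cap_bounds(3)[of n] by simp
    ultimately show ?thesis using that unfolding M_def clamp_msg_eq msg by (simp add: min_absorb1)
  qed
qed

lemma phase_state_step:
  assumes s: "\<And>u. u < n \<Longrightarrow> phase_state p t u (\<sigma> u)" and v: "v < n" and t: "t < phase_length n p"
  shows "phase_state p (Suc t) v (node_step (c v) (\<sigma> v)
    (only_from (insert v (nbs v)) (\<lambda>u. clamp_msg n (node_msg (c u) (\<sigma> u)))))"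
proof -
  define M where "M = only_from (insert v (nbs v)) (\<lambda>u. clamp_msg n (node_msg (c u) (\<sigma> u)))"
  define s' where "s' = node_step (c v) (\<sigma> v) M"
  have less: "u < n" if "u \<in> insert v (nbs v)" for u using that v by (auto simp: nbs_def)
  have M: "M u = clamp_msg n (node_msg (c u) (\<sigma> u))" if "u \<in> insert v (nbs v)" for u
    using that by (simp add: M_def only_from_def)
  note msgs = phase_state_msg[OF s[OF less] less]
  have sv: "phase_no (\<sigma> v) = p" "clock (\<sigma> v) = t"
    "\<And>u. u \<in> insert v (nbs v) \<Longrightarrow> keys_all (\<sigma> v) u = sent {..<n} (min t rounds) u"
    "\<And>u. u \<in> insert v (nbs v) \<Longrightarrow> keys_sample (\<sigma> v) u = sent S (min t rounds) u"
    "rounds \<le> t \<Longrightarrow> best (\<sigma> v) = X (min (t - rounds) (2 * h + 1)) v"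
    "elected \<le> t \<Longrightarrow> bfs (\<sigma> v) = Y (min (t - elected) (4 * h + 1)) v"
    using s[OF v] unfolding phase_state_def by blast+
  have "clock (\<sigma> v) \<noteq> phase_length n (phase_no (\<sigma> v))" using t sv by simp
  note fields = node_step_fields[OF this, of v "nbs v" "r v" M, folded c s'_def, unfolded sv(1,2) ends]
  have ka: "keys_all s' u = sent {..<n} (min (Suc t) rounds) u" if u: "u \<in> insert v (nbs v)" for u
  proof (cases "t < rounds")
    case True
    then have "keys_all s' u = insert (next_key n (nbs u) u (u \<in> {..<n}) (sent {..<n} t)) (sent {..<n} t u)"
      unfolding fields(3) using sv(3)[OF u] M[OF u] msgs(1)[OF u u True] by simp
    then show ?thesis using True by (simp add: min_absorb1 sent.simps(2) Suc_leI)
  qed (use sv(3)[OF u] in \<open>simp add: fields(3)\<close>)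
  have ks: "keys_sample s' u = sent S (min (Suc t) rounds) u" if u: "u \<in> insert v (nbs v)" for u
  proof (cases "t < rounds")
    case True
    then have "keys_sample s' u = insert (next_key n (nbs u) u (u \<in> S) (sent S t)) (sent S t u)"
      unfolding fields(4) using sv(4)[OF u] M[OF u] msgs(2)[OF u u True] by simp
    then show ?thesis using True by (simp add: min_absorb1 sent.simps(2) Suc_leI)
  qed (use sv(4)[OF u] in \<open>simp add: fields(4)\<close>)
  have best: "best s' = X (min (Suc t - rounds) (2 * h + 1)) v" if "rounds \<le> Suc t"
  proof (cases "t < rounds")
    case True
    \<comment> \<open>In the last detection round the key sets become complete, and the election
      value is computed from the updated sets in the same round.\<close>
    then have eq: "Suc t = rounds" using that by simp
    then have "best s' = local_key n (nbs v) v (v \<in> S) h (keys_all s') (keys_sample s')"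
      using True fields(5) sample[OF v] by (simp add: h)
    also have "\<dots> = X0 v"
      unfolding X0_def by (rule local_key_cong) (use ka ks eq in auto)
    finally show ?thesis using eq by (simp add: X_def)
  next
    case False
    show ?thesis
    proof (cases "t < elected")
      case True
      have "best s' = flood_step 0 (nbs v) v (\<lambda>u. snd (snd (M u)))" using True False fields(5) by simp
      also have "\<dots> = flood_step 0 (nbs v) v (X (t - rounds))"
        using False True M msgs(3) by (intro flood_step_cong) simp
      also have "\<dots> = X (Suc (t - rounds)) v" by (simp add: X_def)
      finally show ?thesis using False True by (simp add: elected_def Suc_diff_le min_absorb1)
    next
      case late: False
      then have "best s' = best (\<sigma> v)" using False fields(5) by simp
      then show ?thesis using sv(5) False late by (simp add: elected_def min_absorb2)
    qed
  qed
  have key: "best s' = key v" if "elected \<le> Suc t"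
    using best that by (simp add: key_def elected_def min_absorb2)
  have bfs: "bfs s' = Y (min (Suc t - elected) (4 * h + 1)) v" if "elected \<le> Suc t"
  proof (cases "t < elected")
    case True
    then have eq: "Suc t = elected" using that by simp
    then have "bfs s' = bfs_start n (key v) v" using True fields(6) key by simp
    then show ?thesis using eq by (simp add: Y_def)
  next
    case False
    show ?thesis
    proof (cases "t < searched")
      case True
      have "bfs s' = flood_step 1 (cut_nbs n (key v) (nbs v) v) v (\<lambda>u. snd (snd (M u)))"
        using True False fields(6) key by simp
      also have "\<dots> = flood_step 1 (cut_nbs n (key v) (nbs v) v) v (Y (t - elected))"
        using False True M msgs(4) by (intro flood_step_cong) (auto simp: cut_nbs_def)
      also have "\<dots> = Y (Suc (t - elected)) v" by (simp add: Y_def)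
      finally show ?thesis using False True by (simp add: searched_def Suc_diff_le min_absorb1)
    next
      case late: False
      then have "bfs s' = bfs (\<sigma> v)" using False fields(6) by simp
      then show ?thesis using sv(6) False late by (simp add: searched_def min_absorb2)
    qed
  qed
  have result: "result s' = Z (Suc t - searched) v" if "searched \<le> Suc t"
  proof (cases "t < searched")
    case True
    then have eq: "Suc t = searched" using that by simp
    then have "elected \<le> Suc t" by (simp add: searched_def)
    then have "result s' = out_start n (key v) (Y (4 * h + 1) v) v"
      using True fields(7) key bfs eq by (simp add: searched_def)
    then show ?thesis using eq by (simp add: Z_def)
  next
    case False
    then have "result s' = flood_step 0 (nbs v) v (\<lambda>u. snd (snd (M u)))" using fields(7) by simp
    also have "\<dots> = flood_step 0 (nbs v) v (Z (t - searched))"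
      using False M msgs(5) by (intro flood_step_cong) simp
    also have "\<dots> = Z (Suc (t - searched)) v" by (simp add: Z_def)
    finally show ?thesis using False by (simp add: Suc_diff_le)
  qed
  show ?thesis
    using ka ks best bfs result fields(1,2) unfolding phase_state_def s'_def M_def by blast
qed

lemma phase_state_fresh: "phase_state p 0 v (fresh p)"
  using rounds_pos by (simp add: phase_state_def fresh_def elected_def searched_def)

end
end

section \<open>Round complexity and the theorem\<close>

text \<open>The extra \<open>Suc\<close> is the step that resets to the next guess.\<close>

fun start_time :: "nat \<Rightarrow> nat \<Rightarrow> nat" where
  "start_time n 0 = 0"
| "start_time n (Suc p) = Suc (start_time n p + phase_length n p)"

lemma phase_length_eq: "phase_length n p = budget n + 10 * 2 ^ p + 2"
  by (simp add: phase_length_def end_bfs_def end_elect_def end_detect_def)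

text \<open>A geometric sum, with the 10 moved to the left to avoid subtraction.\<close>

lemma start_time_eq: "start_time n p + 10 = p * (budget n + 3) + 10 * 2 ^ p"
  by (induction p) (simp_all add: phase_length_eq)

lemma time_decompose: "\<exists>p t'. t = start_time n p + t' \<and> t' \<le> phase_length n p"
proof (induction t)
  case 0
  then show ?case by (intro exI[of _ 0]) simp
next
  case (Suc t)
  then obtain p t' where pt: "t = start_time n p + t'" "t' \<le> phase_length n p" by blast
  show ?case
  proof (cases "t' = phase_length n p")
    case True
    then show ?thesis using pt by (intro exI[of _ "Suc p"] exI[of _ 0]) simp
  next
    case False
    then show ?thesis using pt by (intro exI[of _ p] exI[of _ "Suc t'"]) simp
  qed
qed

lemma le_four_power: "n \<le> 4 ^ sample_bits n"
proof -
  have "n < 2 ^ n" by (rule less_exp)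
  also have "(2 :: nat) ^ n \<le> 4 ^ n" by (rule power_mono) simp_all
  finally have "n \<le> 4 ^ n" by simp
  then show ?thesis unfolding sample_bits_def by (rule LeastI)
qed

lemma budget_bounds: 
  assumes n: "3 \<le> n" and "b = sample_bits n" and "L = ln (real n + 2)"
  shows "1 \<le> L" "real b \<le> 2 * L" "real (budget n + 3) \<le> 30 * L * sqrt (real n)"
proof -
  have "exp 1 \<le> real n + 2" using exp_le n by linarith
  then show L: "1 \<le> L" using assms(3) by (simp add: ln_ge_iff)
  have "b \<noteq> 0" using le_four_power[of n] n assms(2) by (cases b) auto
  then obtain a where a: "b = Suc a" by (cases b) auto
  \<comment> \<open>Minimality of \<open>b\<close> gives \<open>4 ^ (b - 1) < n\<close>, from which
    follow both the logarithmic bound on \<open>b\<close> and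
    \<open>2 ^ b \<le> 2 * sqrt n\<close>.\<close>
  have "\<not> n \<le> 4 ^ a" using not_less_Least[of a "\<lambda>b. n \<le> 4 ^ b"] a assms(2)
    unfolding sample_bits_def by simp
  then have "real (4 ^ a) < real n" by (simp only: of_nat_less_iff not_le)
  then have an: "4 ^ a < real n" by simp
  have "(1 :: real) \<le> ln 4" using exp_le by (simp add: ln_ge_iff)
  then have "real a \<le> real a * ln 4" by (simp add: mult_le_cancel_left1)
  also have "\<dots> = ln (4 ^ a)" by (simp add: ln_realpow)
  also have "\<dots> \<le> L"
  proof -
    have "(4 :: real) ^ a \<le> real n + 2" using an by linarith
    then show ?thesis unfolding assms(3) by (rule ln_mono[rotated 2]) simp_all
  qed
  finally show b: "real b \<le> 2 * L" using a L by simp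
  have "(2 ^ a) ^ 2 = ((2 :: real) ^ 2) ^ a" unfolding power_mult[symmetric] by (simp only: mult.commute)
  also have "\<dots> = 4 ^ a" by simp
  finally have "(2 ^ a) ^ 2 = (4 :: real) ^ a" .
  then have "2 ^ a \<le> sqrt (real n)" using an by (intro real_le_rsqrt) simp
  then have q: "2 ^ b \<le> 2 * sqrt (real n)" using a by simp
  have q1: "(1 :: real) \<le> 2 ^ b" by simp
  have "budget n + 3 = 2 ^ b * (2 * b + 1) + 2 * 2 ^ b + (2 * b + 4)"
    unfolding budget_def Let_def assms(2) by linarith
  then have "real (budget n + 3) = 2 ^ b * (2 * real b + 1) + 2 * 2 ^ b + (2 * real b + 4)"
    by (simp only: of_nat_add of_nat_mult of_nat_power of_nat_numeral of_nat_1)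
  also have "2 * real b + 4 = 1 * (2 * real b + 4)" by (rule mult_1_left[symmetric])
  also have "2 ^ b * (2 * real b + 1) + 2 * 2 ^ b + 1 * (2 * real b + 4) \<le> 2 ^ b * (2 * real b + 1) + 2 * 2 ^ b + 2 ^ b * (2 * real b + 4)"
    by (intro add_left_mono mult_right_mono q1) linarith
  also have "\<dots> = 2 ^ b * (4 * real b + 7)" by (simp add: algebra_simps)
  \<comment> \<open>\<open>4 * b + 7\<close> is at most \<open>8 * L + 7 * L\<close>.\<close>
  also have "\<dots> \<le> (2 * sqrt (real n)) * (15 * L)"
    by (rule mult_mono[OF q]) (use b L in \<open>linarith | simp\<close>)+
  also have "\<dots> = 30 * L * sqrt (real n)" by simp
  finally show "real (budget n + 3) \<le> 30 * L * sqrt (real n)" .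
qed

lemma time_bound:
  assumes n: "3 \<le> n" and D: "D < n" and p: "2 ^ p \<le> 2 * D"
  shows "real (start_time n p + phase_length n p) \<le> 180 * ln (real n + 2) ^ 2 * (sqrt (real n) + real D)"
proof -
  define b where "b = sample_bits n"
  define L where "L = ln (real n + 2)"
  note bounds = budget_bounds[OF n b_def L_def]
  \<comment> \<open>As the diameter is below \<open>n\<close>, the phase number is at most
    \<open>2 * b\<close>, hence logarithmic.\<close>
  have "2 ^ p < 2 * (4 ^ b :: nat)" using p D le_four_power[of n] unfolding b_def by linarith
  also have "2 * (4 ^ b :: nat) = 2 ^ (2 * b + 1)" by (simp add: power_mult)
  finally have "p < 2 * b + 1" by (rule power_less_imp_less_exp[rotated]) simp
  then have p1: "real (p + 1) \<le> 5 * L" using bounds(1,2) by linarith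
  have "start_time n p + phase_length n p \<le> (p + 1) * (budget n + 3) + 20 * 2 ^ p"
    using start_time_eq[of n p] by (simp add: phase_length_eq)
  also have "\<dots> \<le> (p + 1) * (budget n + 3) + 40 * D" using p by simp
  finally have "real (start_time n p + phase_length n p) \<le> real ((p + 1) * (budget n + 3) + 40 * D)"
    by (simp only: of_nat_le_iff)
  also have "\<dots> = real (p + 1) * real (budget n + 3) + 40 * real D" by (simp only: of_nat_add of_nat_mult of_nat_numeral)
  also have "\<dots> \<le> (5 * L) * (30 * L * sqrt (real n)) + (40 * real D) * L ^ 2"
  proof (rule add_mono)
    show "real (p + 1) * real (budget n + 3) \<le> (5 * L) * (30 * L * sqrt (real n))"
      using p1 bounds by (intro mult_mono) simp_all
    have "1 \<le> L ^ 2" using bounds(1) by (rule one_le_power)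
    then show "40 * real D \<le> (40 * real D) * L ^ 2" by (simp add: mult_le_cancel_left1)
  qed
  \<comment> \<open>The coefficients 5 * 30 = 150 and 40 are both covered by 180.\<close>
  also have "\<dots> \<le> 180 * L ^ 2 * sqrt (real n) + 180 * L ^ 2 * real D"
  proof (rule add_mono)
    have "L ^ 2 * sqrt (real n) \<ge> 0" by simp
    moreover have "(5 * L) * (30 * L * sqrt (real n)) = 150 * (L ^ 2 * sqrt (real n))"
      by (simp add: power2_eq_square)
    ultimately show "(5 * L) * (30 * L * sqrt (real n)) \<le> 180 * L ^ 2 * sqrt (real n)" by linarith
    have "L ^ 2 * real D \<ge> 0" by simp
    then show "(40 * real D) * L ^ 2 \<le> 180 * L ^ 2 * real D" by (simp add: mult.commute)
  qed
  finally show ?thesis unfolding L_def by (simp add: distrib_left)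
qed

lemma node_step_end:
  "clock s = phase_length n (phase_no s) \<Longrightarrow> node_step (n, v, N, r) s M = fresh (Suc (phase_no s))"
  by (simp add: node_step.simps Let_def)

text \<open>The random bits are constrained only through \<open>few\<close> and \<open>hit\<close>;
  the analysis inside the locale is deterministic.\<close>

locale sampled_network = network +
  fixes r :: "nat \<Rightarrow> bool list" and xs :: "nat list"
  assumes cyc: "is_cycle E xs" and shortest: "length xs = girth E"
    and few: "card (insert 0 {v. v < n \<and> r v = replicate (sample_bits n) True}) \<le> budget n"
    and hit: "(\<forall>x\<in>set xs. card {y. y < n \<and> dist x y \<le> (girth E - 1) div 2} \<le> budget n) \<or>
      (\<exists>x\<in>set xs. \<exists>s<n. r s = replicate (sample_bits n) True \<and> dist s x \<le> (girth E - 1) div 2)"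
begin

definition S where "S = insert 0 {v. v < n \<and> r v = replicate (sample_bits n) True}"

abbreviation state where "state \<equiv> mrun girth_machine n E r"

lemma n_ge_3: "3 \<le> n"
proof -
  have "set xs \<subseteq> {..<n}" using cycle_less cyc by blast
  then have "card (set xs) \<le> n" using card_mono[of "{..<n}"] by fastforce
  then show ?thesis using cyc unfolding is_cycle_def by (simp add: distinct_card)
qed

lemma is_phase: "phase n E S (budget n) xs"
proof unfold_locales
  show "0 \<in> S" by (simp add: S_def)
  show "S \<subseteq> {..<n}" using n_ge_3 by (auto simp: S_def)
  show "card S \<le> budget n" unfolding S_def by (rule few)
  show "(\<forall>x\<in>set xs. card {y. y < n \<and> dist x y \<le> (girth E - 1) div 2} \<le> budget n) \<or>
      (\<exists>x\<in>set xs. \<exists>s\<in>S. dist s x \<le> (girth E - 1) div 2)"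
    using hit unfolding S_def by blast
qed (fact cyc shortest)+

lemma ctx: "node_ctx n E r v = (n, v, nbs v, r v)"
  by (simp add: node_ctx_def nbs_def)

lemma in_sample: "v < n \<Longrightarrow> in_sample (node_ctx n E r v) \<longleftrightarrow> v \<in> S"
  by (auto simp: ctx in_sample.simps S_def)

lemma state_Suc: "state (Suc t) v = node_step (node_ctx n E r v) (state t v)
   (only_from (insert v (nbs v)) (\<lambda>u. clamp_msg n (node_msg (node_ctx n E r u) (state t u))))"
  by (simp add: girth_machine_def nbs_def)

lemma phase_run:
  assumes start: "\<And>v. v < n \<Longrightarrow> state t0 v = fresh p" and "t \<le> phase_length n p" "v < n"
  shows "phase.phase_state n E S (2 ^ p) (budget n) p t v (state (t0 + t) v)"
proof -
  interpret phase n E S "2 ^ p" "budget n" xs by (rule is_phase)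
  show ?thesis using assms(2,3)
  proof (induction t arbitrary: v)
    case 0
    then show ?case using start phase_state_fresh[OF refl refl ctx in_sample] by simp
  next
    case (Suc t)
    show ?case
      unfolding add_Suc_right state_Suc
      by (rule phase_state_step[OF refl refl ctx in_sample]) (use Suc in auto)
  qed
qed

text \<open>A node enters the next phase even if it counted as halted before, so the run is
  described for all times.\<close>

lemma phase_start: "v < n \<Longrightarrow> state (start_time n p) v = fresh p"
proof (induction p arbitrary: v)
  case 0
  then show ?case by (simp add: girth_machine_def)
next
  case (Suc p)
  interpret phase n E S "2 ^ p" "budget n" xs by (rule is_phase)
  have "phase_state p (phase_length n p) v (state (start_time n p + phase_length n p) v)"
    using phase_run[OF Suc.IH _ Suc.prems] by simp
  then have "clock (state (start_time n p + phase_length n p) v) =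
      phase_length n (phase_no (state (start_time n p + phase_length n p) v))"
    "phase_no (state (start_time n p + phase_length n p) v) = p"
    by (simp_all add: phase_state_def)
  then show ?case unfolding start_time.simps state_Suc ctx by (simp add: node_step_end)
qed

lemma halted_iff:
  "all_halted girth_alg n E r t \<longleftrightarrow>
     (\<forall>v<n. clock (state t v) = phase_length n (phase_no (state t v)) \<and> best (state t v) \<noteq> 0)"
  unfolding all_halted_def girth_alg_def c_halted_congest_of[OF graph]
  by (simp add: girth_machine_def ctx)

lemma phase_end:
  assumes "v < n"
  shows "best (state (start_time n p + phase_length n p) v) = phase.key n E S (2 ^ p) (budget n) v"
    and "result (state (start_time n p + phase_length n p) v) =
      phase.Z n E S (2 ^ p) (budget n) (2 * 2 ^ p) v"
proof -
  interpret phase n E S "2 ^ p" "budget n" xs by (rule is_phase)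
  note ends = ends[OF refl refl ctx in_sample]
  have state: "phase_state p (phase_length n p) v (state (start_time n p + phase_length n p) v)"
    using phase_run[OF phase_start _ assms] by simp
  then show "best (state (start_time n p + phase_length n p) v) = key v"
    by (simp add: phase_state_def ends key_def elected_def searched_def min_absorb2)
  show "result (state (start_time n p + phase_length n p) v) = Z (2 * 2 ^ p) v"
    using state by (simp add: phase_state_def ends)
qed

lemma halts:
  assumes "\<And>v. v < n \<Longrightarrow> dist 0 v \<le> 2 ^ p"
  shows "all_halted girth_alg n E r (start_time n p + phase_length n p)"
proof -
  interpret phase n E S "2 ^ p" "budget n" xs by (rule is_phase)
  show ?thesis unfolding halted_iff
  proof (intro allI impI conjI)
    fix v assume v: "v < n"
    show "clock (state (start_time n p + phase_length n p) v) =
      phase_length n (phase_no (state (start_time n p + phase_length n p) v))"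
      using phase_run[OF phase_start le_refl v, of p] by (simp add: phase_state_def)
    show "best (state (start_time n p + phase_length n p) v) \<noteq> 0"
      unfolding phase_end(1)[OF v] using key_nonzeroI[OF assms v] .
  qed
qed

text \<open>The least halting time may belong to a smaller guess than the one supplied to
  \<open>halts\<close>, so every time at which all nodes have halted is covered.\<close>

lemma halted_correct:
  assumes "all_halted girth_alg n E r t"
  shows "\<exists>g'. (\<forall>v<n. result (state t v) = g') \<and> girth E \<le> g' \<and> g' \<le> 2 * girth E - 1 \<and>
    (\<exists>ys. is_cycle E ys \<and> length ys = g')"
proof -
  obtain p t' where t: "t = start_time n p + t'" "t' \<le> phase_length n p"
    using time_decompose by blast
  interpret phase n E S "2 ^ p" "budget n" xs by (rule is_phase)
  have "phase_state p t' 0 (state t 0)"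
    unfolding t(1) using phase_run[OF phase_start t(2) n_pos] .
  \<comment> \<open>Halting requires the final clock value, so \<open>t\<close> is the end of a
    phase.\<close>
  then have t': "t' = phase_length n p"
    using assms n_pos unfolding halted_iff by (auto simp: phase_state_def)
  have "key v \<noteq> 0" if "v < n" for v
  proof -
    have "best (state (start_time n p + phase_length n p) v) \<noteq> 0"
      using assms that unfolding halted_iff t t' by blast
    then show ?thesis unfolding phase_end(1)[OF that] .
  qed
  then show ?thesis
    using phase_correct phase_end(2) unfolding t t' by simp
qed

lemma some_phase_suffices:
  obtains p where "\<forall>v<n. dist 0 v \<le> 2 ^ p" "2 ^ p \<le> 2 * hop_diameter n E"
proof -
  have n: "0 < n" "1 < n" using n_ge_3 by auto
  define p where "p = (LEAST p. \<forall>v<n. dist 0 v \<le> 2 ^ p)"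
  have "\<forall>v<n. dist 0 v \<le> 2 ^ n"
    using dist_less[OF n(1)] less_exp by (meson less_imp_le less_trans)
  then have p: "\<forall>v<n. dist 0 v \<le> 2 ^ p" unfolding p_def by (rule LeastI)
  have "2 ^ p \<le> 2 * hop_diameter n E"
  proof (cases p)
    case 0
    \<comment> \<open>With no earlier guess that failed, a diameter of at least 1 is needed; nodes 0
      and 1 provide it.\<close>
    have "dist 0 1 \<noteq> 0" using dist_eq_0[OF n] by auto
    then show ?thesis using dist_le_diameter[OF n] 0 by simp
  next
    case (Suc q)
    then have "\<not> (\<forall>v<n. dist 0 v \<le> 2 ^ q)"
      unfolding p_def by (intro not_less_Least) (simp add: p_def)
    then obtain v where "v < n" "2 ^ q < dist 0 v" by (auto simp: not_le)
    then show ?thesis using dist_le_diameter[OF n(1)] Suc by fastforce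
  qed
  then show thesis using that p by blast
qed

lemma diameter_less: "hop_diameter n E < n"
proof -
  have "0 < n" using n_ge_3 by simp
  then obtain u v where "u < n" "v < n" "hop_diameter n E = dist u v" by (rule diameter_attained)
  then show ?thesis using dist_less by simp
qed

theorem run_correct:
  "(\<exists>t. all_halted girth_alg n E r t) \<and>
   real (term_round girth_alg n E r)
     \<le> 180 * (ln (real n + 2)) ^ 2 * (sqrt (real n) + real (hop_diameter n E)) \<and>
   (\<exists>g'. (\<forall>v<n. c_out girth_alg (exec girth_alg n E r (term_round girth_alg n E r) v) = g') \<and>
         girth E \<le> g' \<and> real g' \<le> (2 - 1 / real (girth E)) * real (girth E) \<and>
         (\<exists>xs. is_cycle E xs \<and> length xs = g'))"
proof -
  obtain p where p: "\<forall>v<n. dist 0 v \<le> 2 ^ p" "2 ^ p \<le> 2 * hop_diameter n E"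
    by (rule some_phase_suffices)
  let ?T = "start_time n p + phase_length n p"
  have halt: "all_halted girth_alg n E r ?T" using p(1) by (intro halts) blast
  then have "all_halted girth_alg n E r (term_round girth_alg n E r)"
    unfolding term_round_def by (rule LeastI)
  then obtain g' ys where g': "\<forall>v<n. result (state (term_round girth_alg n E r) v) = g'"
      "girth E \<le> g'" "g' \<le> 2 * girth E - 1" "is_cycle E ys" "length ys = g'"
    using halted_correct by blast
  have out: "c_out girth_alg (exec girth_alg n E r t v) = result (state t v)" for t v
    unfolding girth_alg_def c_out_congest_of[OF graph] by (simp add: girth_machine_def)
  have girth: "3 \<le> girth E" using cyc shortest unfolding is_cycle_def by simp
  then have "real g' \<le> 2 * real (girth E) - 1" using g'(3) by linarith
  also have "\<dots> = (2 - 1 / real (girth E)) * real (girth E)" using girth by (simp add: field_simps)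
  finally have ratio: "real g' \<le> (2 - 1 / real (girth E)) * real (girth E)" .
  have "term_round girth_alg n E r \<le> ?T" unfolding term_round_def using halt by (rule Least_le)
  then have "real (term_round girth_alg n E r) \<le> real ?T" by (simp only: of_nat_le_iff)
  also have "\<dots> \<le> 180 * (ln (real n + 2)) ^ 2 * (sqrt (real n) + real (hop_diameter n E))"
    by (rule time_bound[OF n_ge_3 diameter_less p(2)])
  finally have time: "real (term_round girth_alg n E r)
     \<le> 180 * (ln (real n + 2)) ^ 2 * (sqrt (real n) + real (hop_diameter n E))" .
  show ?thesis
  proof (intro conjI exI)
    show "\<forall>v<n. c_out girth_alg (exec girth_alg n E r (term_round girth_alg n E r) v) = g'"
      unfolding out by (rule g'(1))
  qed (fact halt time g'(2) ratio g'(4,5))+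
qed

end

theorem theorem6:
  shows "\<exists>(A :: congest_alg) (B :: real) (C :: real) (k :: nat).
    congest_bandwidth A B \<and>
    (\<forall>n E. graph_on n E \<and> connected_graph n E \<and> has_cycle E \<longrightarrow>
       measure_pmf.prob (rand_bits A n)
         {r. (\<exists>t. all_halted A n E r t) \<and>
             real (term_round A n E r)
               \<le> C * (ln (real n + 2)) ^ k * (sqrt (real n) + real (hop_diameter n E)) \<and>
             (\<exists>g'. (\<forall>v<n. c_out A (exec A n E r (term_round A n E r) v) = g') \<and>
                   girth E \<le> g' \<and>
                   real g' \<le> (2 - 1 / real (girth E)) * real (girth E) \<and>
                   (\<exists>xs. is_cycle E xs \<and> length xs = g'))}
       \<ge> 1 - 1 / real n)"
proof (intro exI conjI allI impI)
  show "congest_bandwidth girth_alg 30"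
    unfolding girth_alg_def by (rule congest_of_bandwidth)
  fix n E
  assume asm: "graph_on n E \<and> connected_graph n E \<and> has_cycle E"
  interpret network n E using asm by unfold_locales auto
  have "\<exists>k xs. is_cycle E xs \<and> length xs = k" using asm unfolding has_cycle_def by blast
  then have "\<exists>xs. is_cycle E xs \<and> length xs = girth E" unfolding girth_def by (rule LeastI_ex)
  then obtain xs where xs: "is_cycle E xs" "length xs = girth E" by blast
  define ball where "ball x = {y. y < n \<and> dist x y \<le> (girth E - 1) div 2}" for x
  \<comment> \<open>A vertex with a large ball, if there is one, is fixed before the bits are drawn:
    hitting this one ball suffices, so no union bound over the cycle arises.\<close>
  obtain x where x: "x \<in> set xs"
      "(\<exists>y\<in>set xs. budget n < card (ball y)) \<longrightarrow> budget n < card (ball x)"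
  proof (cases "\<exists>y\<in>set xs. budget n < card (ball y)")
    case False
    have "hd xs \<in> set xs" using xs(1) unfolding is_cycle_def by (cases xs) auto
    then show ?thesis using that False by blast
  qed (use that in blast)
  have xn: "x < n" using cycle_less xs(1) x(1) by blast
  define b where "b = sample_bits n"
  let ?good = "{r. (2 ^ b * (2 * b + 1) \<le> card (ball x) \<longrightarrow> (\<exists>v\<in>ball x. r v = replicate b True)) \<and>
        card {v. v < n \<and> r v = replicate b True} \<le> 2 * 2 ^ b + 2 * b}"
  have rand: "rand_bits girth_alg n = Pi_pmf {..<n} [] (\<lambda>_. pmf_of_set {xs. length xs = b})"
    by (simp add: rand_bits_def girth_alg_def congest_of_def b_def)
  have "1 - 1 / real n \<le> measure_pmf.prob (rand_bits girth_alg n) ?good"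
    unfolding rand using xn le_four_power[of n] by (intro prob_good) (auto simp: b_def ball_def)
  also have "\<dots> \<le> measure_pmf.prob (rand_bits girth_alg n)
         {r. (\<exists>t. all_halted girth_alg n E r t) \<and>
             real (term_round girth_alg n E r)
               \<le> 180 * (ln (real n + 2)) ^ 2 * (sqrt (real n) + real (hop_diameter n E)) \<and>
             (\<exists>g'. (\<forall>v<n. c_out girth_alg (exec girth_alg n E r (term_round girth_alg n E r) v) = g') \<and>
                   girth E \<le> g' \<and>
                   real g' \<le> (2 - 1 / real (girth E)) * real (girth E) \<and>
                   (\<exists>xs. is_cycle E xs \<and> length xs = g'))}"
  proof (rule measure_pmf.finite_measure_mono; (intro subsetI)?)
    fix r assume r: "r \<in> ?good"
    have "sampled_network n E r xs"
    proof unfold_locales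
      have "card (insert 0 {v. v < n \<and> r v = replicate b True})
          \<le> Suc (card {v. v < n \<and> r v = replicate b True})"
        by (rule card_insert_le_m1) simp_all
      then show "card (insert 0 {v. v < n \<and> r v = replicate (sample_bits n) True}) \<le> budget n"
        using r by (simp add: budget_def Let_def b_def)
      \<comment> \<open>A ball larger than the whole budget also exceeds the threshold of
        \<open>prob_good\<close>.\<close>
      have large: "2 ^ b * (2 * b + 1) \<le> budget n" by (simp add: budget_def Let_def b_def)
      show "(\<forall>x\<in>set xs. card {y. y < n \<and> dist x y \<le> (girth E - 1) div 2} \<le> budget n) \<or>
        (\<exists>x\<in>set xs. \<exists>s<n. r s = replicate (sample_bits n) True \<and> dist s x \<le> (girth E - 1) div 2)"
      proof (cases "budget n < card (ball x)")
        case False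
        then show ?thesis using x(2) unfolding ball_def by (auto simp: not_less)
      next
        case True
        then have "2 ^ b * (2 * b + 1) \<le> card (ball x)" using large by linarith
        then obtain s where s: "s \<in> ball x" "r s = replicate b True" using r by blast
        then have "s < n" "dist s x \<le> (girth E - 1) div 2"
          using dist_sym[OF xn, of s] by (auto simp: ball_def)
        then show ?thesis using s x(1) unfolding b_def by blast
      qed
    qed (fact xs)+
    then show "r \<in> {r. (\<exists>t. all_halted girth_alg n E r t) \<and>
             real (term_round girth_alg n E r)
               \<le> 180 * (ln (real n + 2)) ^ 2 * (sqrt (real n) + real (hop_diameter n E)) \<and>
             (\<exists>g'. (\<forall>v<n. c_out girth_alg (exec girth_alg n E r (term_round girth_alg n E r) v) = g') \<and>
                   girth E \<le> g' \<and>
                   real g' \<le> (2 - 1 / real (girth E)) * real (girth E) \<and>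
                   (\<exists>xs. is_cycle E xs \<and> length xs = g'))}"
      by (intro CollectI sampled_network.run_correct)
  qed simp
  finally show "1 - 1 / real n \<le> measure_pmf.prob (rand_bits girth_alg n)
         {r. (\<exists>t. all_halted girth_alg n E r t) \<and>
             real (term_round girth_alg n E r)
               \<le> 180 * (ln (real n + 2)) ^ 2 * (sqrt (real n) + real (hop_diameter n E)) \<and>
             (\<exists>g'. (\<forall>v<n. c_out girth_alg (exec girth_alg n E r (term_round girth_alg n E r) v) = g') \<and>
                   girth E \<le> g' \<and>
                   real g' \<le> (2 - 1 / real (girth E)) * real (girth E) \<and>
                   (\<exists>xs. is_cycle E xs \<and> length xs = g'))}" .
qed

end
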